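(* Let $\mathcal{A}$ be an edit-distance approximation algorithm with approximation function $\gamma$ and running-time function $T$ as described in the context, and let Algorithm B be the recursive procedure described in the context. For all strings $u, v$ with $|u| + |v| \le n$ and every integer $m \ge 2$, Algorithm B (run with parameter $m$ and black box $\mathcal{A}$) outputs an alignment from $u$ to $v$ whose number of edits is at most $(3\gamma(n))^{O(\log_m n)} \cdot \Delta_{\text{ed}}(u,v)$. Moreover, it runs in time $\tilde{O}(m^5 \cdot T(n))$.
   Context: The edit distance $\Delta_{\text{ed}}(x,y)$ is the minimum number of single-character insertions, deletions and substitutions transforming $x$ into $y$; an alignment from $x$ to $y$ is a sequence of such edits transforming $x$ into $y$. For a string $u$, $u[i:j]$ denotes $u_i u_{i+1}\cdots u_j$ (empty if $j<i$). A partition of a string $u$ into $m$ parts is a tuple $(p_0,\dots,p_m)$ with $0=p_0\le p_1\le\cdots\le p_m=|u|$; its $i$-th part is $u[p_{i-1}+1:p_i]$. An equipartition is a partition whose parts all have size $\lfloor |u|/m\rfloor$ or $\lceil |u|/m\rceil$. The black box $\mathcal{A}$ satisfies: (1) there is a non-decreasing function $\gamma$ such that for all $n>0$ and all strings $u,v$ with $|u|+|v|\le n$, $\Delta_{\text{ed}}(u,v)\le \mathcal{A}(u,v)\le \gamma(n)\Delta_{\text{ed}}(u,v)$; (2) $\mathcal{A}(u,v)$ runs in time at most $T(n)$ for a non-decreasing function $T$ with $T(j)+T(k)\le T(j+k)$ for all $j,k\ge 0$. Algorithm B on input $u,v$ with parameter $m\ge 2$: (1) if $|u|\le 1$, find an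 optimal alignment naively in time $O(|v|)$. (2) Let $P=(p_0,\dots,p_m)$ be an equipartition of $u$ with parts $P_i$. (3) Let $S = \big(\{p_0,\dots,p_m\}\cup\{|v|\}\cup\{\lceil p_i \pm (1+\tfrac1m)^j\rceil : i,j\ge 0\}\big)\cap\{0,\dots,|v|\}$. (4) By dynamic programming (subproblem $f(l,j)$ for $l\in S$: best choice of $q_0,\dots,q_j$ with $q_j=l$, computed from all $f(l',j-1)$ with $l'\le l$, $l'\in S$, adding $\mathcal{A}(P_j, v[l'+1:l])$), find a partition $Q=(q_0,\dots,q_m)$ of $v$ with every $q_i\in S$ minimizing $\sum_{i=1}^m \mathcal{A}(P_i,Q_i)$, where $Q_i$ is the $i$-th part of $Q$. (5) Recurse on each pair $(P_i,Q_i)$ and concatenate the resulting alignments into an alignment from $u$ to $v$. $\tilde O$ hides polylogarithmic factors in $n$.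
   Formalization: The exponent O(log_m n) is read as O(max(1, log_m n)), since for m much larger than n the literal bound fails; n > 0 is assumed, and a black-box call is taken to cost at least one step unless both strings are empty, when it costs none (as T(0)=0). *)

theory Defs
  imports Complex_Main
begin

section \<open>Edit distance and alignments\<close>

text \<open>
  Strings are lists over an arbitrary alphabet. Edits address positions from 0 in the
  current (already edited) string.
\<close>

datatype 'a edit = Ins nat 'a | Del nat | Sub nat 'a

primrec apply_edit :: "'a edit \<Rightarrow> 'a list \<Rightarrow> 'a list option" where
  "apply_edit (Ins i c) x = (if i \<le> length x then Some (take i x @ c # drop i x) else None)"
| "apply_edit (Del i) x = (if i < length x then Some (take i x @ drop (Suc i) x) else None)"
| "apply_edit (Sub i c) x = (if i < length x then Some (x[i := c]) else None)"

primrec alignment :: "'a edit list \<Rightarrow> 'a list \<Rightarrow> 'a list \<Rightarrow> bool" where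
  "alignment [] x y \<longleftrightarrow> x = y"
| "alignment (e # es) x y \<longleftrightarrow> (\<exists>z. apply_edit e x = Some z \<and> alignment es z y)"

definition edit_dist :: "'a list \<Rightarrow> 'a list \<Rightarrow> nat" where
  "edit_dist x y = (LEAST k. \<exists>es. alignment es x y \<and> length es = k)"

primrec shift_edit :: "nat \<Rightarrow> 'a edit \<Rightarrow> 'a edit" where
  "shift_edit d (Ins i c) = Ins (i + d) c"
| "shift_edit d (Del i) = Del (i + d)"
| "shift_edit d (Sub i c) = Sub (i + d) c"


section \<open>Partitions\<close>

text \<open>\<open>slice a b u\<close> is the substring $u[a+1:b]$ in 1-based notation.\<close>

definition slice :: "nat \<Rightarrow> nat \<Rightarrow> 'a list \<Rightarrow> 'a list" where
  "slice a b u = take (b - a) (drop a u)"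

definition is_partition :: "nat \<Rightarrow> 'a list \<Rightarrow> nat list \<Rightarrow> bool" where
  "is_partition m u P \<longleftrightarrow>
     length P = m + 1 \<and> P ! 0 = 0 \<and> sorted P \<and> P ! m = length u"

definition is_equipartition :: "nat \<Rightarrow> 'a list \<Rightarrow> nat list \<Rightarrow> bool" where
  "is_equipartition m u P \<longleftrightarrow> is_partition m u P \<and>
     (\<forall>i<m. int (P ! Suc i - P ! i)
        \<in> {\<lfloor>real (length u) / real m\<rfloor>, \<lceil>real (length u) / real m\<rceil>})"

definition parts :: "nat list \<Rightarrow> 'a list \<Rightarrow> 'a list list" where
  "parts P u = map2 (\<lambda>a b. slice a b u) P (tl P)"


section \<open>The black box\<close>

text \<open>
  \<open>A u v\<close> is the value returned by the black box and \<open>tA u v\<close> the number of steps it takes.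
\<close>

definition approximates ::
  "('a list \<Rightarrow> 'a list \<Rightarrow> real) \<Rightarrow> (nat \<Rightarrow> real) \<Rightarrow> bool" where
  "approximates A \<gamma> \<longleftrightarrow> mono \<gamma> \<and>
     (\<forall>n>0. \<forall>u v. length u + length v \<le> n \<longrightarrow>
        real (edit_dist u v) \<le> A u v \<and> A u v \<le> \<gamma> n * real (edit_dist u v))"

text \<open>
  Superadditivity forces \<open>T 0 = 0\<close>, so a call on two empty strings has no steps of its own;
  any other call is taken to last at least one step, as otherwise \<open>T = 0\<close> would be admitted.
\<close>

definition runs_in_time ::
  "('a list \<Rightarrow> 'a list \<Rightarrow> nat) \<Rightarrow> (nat \<Rightarrow> real) \<Rightarrow> bool" where
  "runs_in_time tA T \<longleftrightarrow> mono T \<and> (\<forall>j k. T j + T k \<le> T (j + k)) \<and>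
     (\<forall>n u v. length u + length v \<le> n \<longrightarrow> real (tA u v) \<le> T n) \<and>
     (\<forall>u v. u \<noteq> [] \<or> v \<noteq> [] \<longrightarrow> 1 \<le> tA u v)"


section \<open>Nondeterministic computations with step counting\<close>

text \<open>
  A computation is the set of its possible outcomes, each paired with the number of steps
  taken to reach it. Nondeterminism covers the choices the algorithm leaves open: the
  equipartition, the optimal alignment in the base case, and ties in minimization.
  Arithmetic (including on reals), comparisons and list-cell operations are unit-cost;
  strings are arrays, and copying a substring costs its length.
\<close>

type_synonym 'r comp = "('r \<times> nat) set"

definition ret :: "'r \<Rightarrow> 'r comp" where
  "ret x = {(x, 0)}"

definition tick :: "nat \<Rightarrow> 'r comp \<Rightarrow> 'r comp" where
  "tick k M = {(x, k + t) | x t. (x, t) \<in> M}"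

definition bind_comp :: "'r comp \<Rightarrow> ('r \<Rightarrow> 's comp) \<Rightarrow> 's comp"  (infixr "\<triangleright>" 54) where
  "M \<triangleright> F = {(y, s + t) | x s y t. (x, s) \<in> M \<and> (y, t) \<in> F x}"

primrec mapM_comp :: "('x \<Rightarrow> 'r comp) \<Rightarrow> 'x list \<Rightarrow> 'r list comp" where
  "mapM_comp F [] = ret []"
| "mapM_comp F (x # xs) =
     tick 1 (F x \<triangleright> (\<lambda>y. mapM_comp F xs \<triangleright> (\<lambda>ys. ret (y # ys))))"

lemma bind_comp_cong [fundef_cong]:
  assumes "M = M'" and "\<And>x t. (x, t) \<in> M' \<Longrightarrow> F x = F' x"
  shows "M \<triangleright> F = M' \<triangleright> F'"
  using assms unfolding bind_comp_def by blast

lemma tick_cong [fundef_cong]: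
  "k = k' \<Longrightarrow> M = M' \<Longrightarrow> tick k M = tick k' M'"
  by simp

lemma mapM_comp_cong [fundef_cong]:
  assumes "xs = ys" and "\<And>x. x \<in> set ys \<Longrightarrow> F x = G x"
  shows "mapM_comp F xs = mapM_comp G ys"
  unfolding assms(1) using assms(2) by (induction ys) simp_all


section \<open>Algorithm B\<close>

definition base_comp :: "'a list \<Rightarrow> 'a list \<Rightarrow> 'a edit list comp" where
  "base_comp u v =
     {(es, length v + 1) | es. alignment es u v \<and> length es = edit_dist u v}"

text \<open>Only parameters \<open>m \<ge> 2\<close> are admitted; otherwise the recursion need not terminate.\<close>

definition equipartition_comp :: "nat \<Rightarrow> 'a list \<Rightarrow> nat list comp" where
  "equipartition_comp m u = {(P, m + 1) | P. 2 \<le> m \<and> is_equipartition m u P}"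

definition candidates :: "nat \<Rightarrow> nat list \<Rightarrow> nat \<Rightarrow> nat set" where
  "candidates m P L =
     {s. s \<le> L \<and>
         int s \<in> int ` set P \<union> {int L}
           \<union> {\<lceil>real p + (1 + 1 / real m) ^ j\<rceil> | p j. p \<in> set P}
           \<union> {\<lceil>real p - (1 + 1 / real m) ^ j\<rceil> | p j. p \<in> set P}}"

text \<open>Successive multiplication by \<open>1 + 1/m\<close> until the bound \<open>N\<close> is exceeded.\<close>

definition powers_comp :: "nat \<Rightarrow> nat \<Rightarrow> real list comp" where
  "powers_comp m N =
     (let J = (LEAST j. real N < (1 + 1 / real m) ^ j)
      in {(map (\<lambda>j. (1 + 1 / real m) ^ j) [0..<J], J + 1)})"

primrec remdups_comp :: "'b list \<Rightarrow> 'b list comp" where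
  "remdups_comp [] = ret []"
| "remdups_comp (x # xs) =
     remdups_comp xs \<triangleright> (\<lambda>ys. tick (length ys + 1) (ret (List.insert x ys)))"

text \<open>
  For \<open>p \<le> K\<close>, powers \<open>x > K + L\<close> yield no element of \<open>{0..L}\<close>, up to the rounding
  of \<open>p - x\<close>, which accounts for the extra 1 in the bound.
\<close>

definition candidates_comp :: "nat \<Rightarrow> nat list \<Rightarrow> nat \<Rightarrow> nat \<Rightarrow> nat list comp" where
  "candidates_comp m P K L =
     powers_comp m (K + L + 1) \<triangleright> (\<lambda>xs.
       let raw = map int P @ [int L] @
                 concat (map (\<lambda>p. map (\<lambda>x. \<lceil>real p + x\<rceil>) xs @ map (\<lambda>x. \<lceil>real p - x\<rceil>) xs) P)
       in tick (length raw) (remdups_comp (map nat (filter (\<lambda>z. 0 \<le> z \<and> z \<le> int L) raw))))"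

lemma set_remdups_comp: "(ys, t) \<in> remdups_comp xs \<Longrightarrow> set ys = set xs \<and> distinct ys"
  by (induction xs arbitrary: ys t)
     (auto simp: ret_def bind_comp_def tick_def)

lemma set_candidates_comp:
  assumes "(S, t) \<in> candidates_comp m P K L" and "2 \<le> m" and "\<forall>p\<in>set P. p \<le> K"
  shows "set S = candidates m P L \<and> distinct S"
proof -
  let ?b = "1 + 1 / real m"
  let ?N = "K + L + 1"
  define J where "J = (LEAST j. real ?N < ?b ^ j)"
  have b: "1 < ?b" using assms(2) by simp
  then obtain j0 where "real ?N < ?b ^ j0" using real_arch_pow by blast
  then have J: "real ?N < ?b ^ J" unfolding J_def by (rule LeastI)
  define raw where "raw = map int P @ [int L] @
    concat (map (\<lambda>p. map (\<lambda>x. \<lceil>real p + x\<rceil>) (map (\<lambda>j. ?b ^ j) [0..<J]) @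
                   map (\<lambda>x. \<lceil>real p - x\<rceil>) (map (\<lambda>j. ?b ^ j) [0..<J])) P)"
  obtain t' where "(S, t') \<in> remdups_comp (map nat (filter (\<lambda>z. 0 \<le> z \<and> z \<le> int L) raw))"
    using assms(1) unfolding candidates_comp_def powers_comp_def bind_comp_def tick_def Let_def
      J_def raw_def by auto
  from set_remdups_comp[OF this] have dS: "distinct S"
    and S: "set S = nat ` {z \<in> set raw. 0 \<le> z \<and> z \<le> int L}" by auto
  have plus: "j < J" if "p \<in> set P" "\<lceil>real p + ?b ^ j\<rceil> \<le> int L" for p j
  proof (rule ccontr)
    assume "\<not> j < J"
    then have "?b ^ J \<le> ?b ^ j" using b by (intro power_increasing) auto
    moreover have "real p + ?b ^ j \<le> real L" using that(2) by (simp add: ceiling_le_iff)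
    ultimately show False using J by simp
  qed
  have minus: "j < J" if "p \<in> set P" "0 \<le> \<lceil>real p - ?b ^ j\<rceil>" for p j
  proof (rule ccontr)
    assume "\<not> j < J"
    then have "?b ^ J \<le> ?b ^ j" using b by (intro power_increasing) auto
    moreover have "- 1 < real p - ?b ^ j" using that(2) by (simp add: le_ceiling_iff)
    moreover have "real p \<le> real K" using assms(3) that(1) by simp
    ultimately show False using J by simp
  qed
  have raw: "z \<in> set raw \<longleftrightarrow> z \<in> int ` set P \<union> {int L}
           \<union> {\<lceil>real p + ?b ^ j\<rceil> | p j. p \<in> set P}
           \<union> {\<lceil>real p - ?b ^ j\<rceil> | p j. p \<in> set P}" if "0 \<le> z" "z \<le> int L" for z
  proof
    assume "z \<in> set raw"
    then show "z \<in> int ` set P \<union> {int L}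
           \<union> {\<lceil>real p + ?b ^ j\<rceil> | p j. p \<in> set P}
           \<union> {\<lceil>real p - ?b ^ j\<rceil> | p j. p \<in> set P}"
      unfolding raw_def by auto
  next
    assume "z \<in> int ` set P \<union> {int L}
           \<union> {\<lceil>real p + ?b ^ j\<rceil> | p j. p \<in> set P}
           \<union> {\<lceil>real p - ?b ^ j\<rceil> | p j. p \<in> set P}"
    then consider "z \<in> int ` set P" | "z = int L"
      | p j where "z = \<lceil>real p + ?b ^ j\<rceil>" "p \<in> set P"
      | p j where "z = \<lceil>real p - ?b ^ j\<rceil>" "p \<in> set P" by blast
    then show "z \<in> set raw"
    proof cases
      case 3
      then have "j < J" using plus that by blast
      then have "\<exists>p\<in>set P. \<exists>j\<in>{0..<J}. z = \<lceil>real p + ?b ^ j\<rceil>"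
        using 3 by (intro bexI[of _ p] bexI[of _ j]) auto
      then show ?thesis unfolding raw_def by (simp add: image_iff) blast
    next
      case 4
      then have "j < J" using minus that by blast
      then have "\<exists>p\<in>set P. \<exists>j\<in>{0..<J}. z = \<lceil>real p - ?b ^ j\<rceil>"
        using 4 by (intro bexI[of _ p] bexI[of _ j]) auto
      then show ?thesis unfolding raw_def by (simp add: image_iff) blast
    qed (auto simp: raw_def)
  qed
  have "s \<in> set S \<longleftrightarrow> s \<in> candidates m P L" for s
  proof -
    have "s \<in> set S \<longleftrightarrow> int s \<in> set raw \<and> s \<le> L"
      unfolding S by (force simp: image_iff)
    also have "\<dots> \<longleftrightarrow> s \<in> candidates m P L"
      unfolding candidates_def using raw[of "int s"] by auto
    finally show ?thesis .
  qed
  then show ?thesis using dS by blast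
qed

text \<open>
  An entry \<open>(l, c, [q\<^sub>j, \<dots>, q\<^sub>0])\<close> of the \<open>j\<close>-th row solves the subproblem
  \<open>f(l, j)\<close>: it has \<open>q\<^sub>j = l\<close> and cost \<open>c\<close>. In row 0 only \<open>l = 0\<close> is feasible.
\<close>

type_synonym dp_entry = "nat \<times> real \<times> nat list"

definition blackbox_comp ::
  "('a list \<Rightarrow> 'a list \<Rightarrow> real) \<Rightarrow> ('a list \<Rightarrow> 'a list \<Rightarrow> nat) \<Rightarrow>
   'a list \<Rightarrow> 'a list \<Rightarrow> real comp" where
  "blackbox_comp A tA u v = {(A u v, tA u v + 1)}"

definition cheapest_comp :: "dp_entry list \<Rightarrow> dp_entry comp" where
  "cheapest_comp es =
     {(e, length es) | e. e \<in> set es \<and> (\<forall>e'\<in>set es. fst (snd e) \<le> fst (snd e'))}"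

definition dp_entry_comp ::
  "('a list \<Rightarrow> 'a list \<Rightarrow> real) \<Rightarrow> ('a list \<Rightarrow> 'a list \<Rightarrow> nat) \<Rightarrow>
   'a list \<Rightarrow> 'a list \<Rightarrow> dp_entry list \<Rightarrow> nat \<Rightarrow> dp_entry comp" where
  "dp_entry_comp A tA p v row l =
     tick (length row)
       (mapM_comp
          (\<lambda>(l', c, qs). tick (l - l' + 1)
             (blackbox_comp A tA p (slice l' l v) \<triangleright> (\<lambda>a. ret (l, c + a, l # qs))))
          (filter (\<lambda>e. fst e \<le> l) row)
        \<triangleright> cheapest_comp)"

primrec dp_rows_comp ::
  "('a list \<Rightarrow> 'a list \<Rightarrow> real) \<Rightarrow> ('a list \<Rightarrow> 'a list \<Rightarrow> nat) \<Rightarrow>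
   'a list \<Rightarrow> nat list \<Rightarrow> 'a list list \<Rightarrow> dp_entry list \<Rightarrow> dp_entry list comp" where
  "dp_rows_comp A tA v S [] row = ret row"
| "dp_rows_comp A tA v S (p # ps) row =
     mapM_comp (dp_entry_comp A tA p v row) S \<triangleright> dp_rows_comp A tA v S ps"

definition partition_comp ::
  "('a list \<Rightarrow> 'a list \<Rightarrow> real) \<Rightarrow> ('a list \<Rightarrow> 'a list \<Rightarrow> nat) \<Rightarrow>
   'a list list \<Rightarrow> 'a list \<Rightarrow> nat list \<Rightarrow> nat list comp" where
  "partition_comp A tA ps v S =
     dp_rows_comp A tA v S ps [(0, 0, [0])] \<triangleright> (\<lambda>row.
       {(rev qs, length row + length ps + 1) | qs c. (length v, c, qs) \<in> set row})"

lemma mapM_comp_all2: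
  "(ys, t) \<in> mapM_comp F xs \<Longrightarrow> list_all2 (\<lambda>x y. \<exists>s. (y, s) \<in> F x) xs ys"
  by (induction xs arbitrary: ys t)
     (fastforce simp: ret_def bind_comp_def tick_def)+

text \<open>The dynamic program returns a minimizer among all partitions with positions in \<open>S\<close>.\<close>

definition chain :: "nat list \<Rightarrow> nat \<Rightarrow> nat \<Rightarrow> nat list \<Rightarrow> bool" where
  "chain S k l Q \<longleftrightarrow>
     length Q = Suc k \<and> Q ! 0 = 0 \<and> sorted Q \<and> Q ! k = l \<and> set Q \<subseteq> set S"

definition chain_cost ::
  "('a list \<Rightarrow> 'a list \<Rightarrow> real) \<Rightarrow> 'a list list \<Rightarrow> 'a list \<Rightarrow> nat list \<Rightarrow> real" where
  "chain_cost A ps v Q = (\<Sum>i<length ps. A (ps ! i) (slice (Q ! i) (Q ! Suc i) v))"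

definition row_ok ::
  "('a list \<Rightarrow> 'a list \<Rightarrow> real) \<Rightarrow> 'a list \<Rightarrow> nat list \<Rightarrow> 'a list list \<Rightarrow> dp_entry list \<Rightarrow> bool" where
  "row_ok A v S ps row \<longleftrightarrow>
     (\<forall>(l, c, qs) \<in> set row. chain S (length ps) l (rev qs) \<and> c = chain_cost A ps v (rev qs) \<and>
        (\<forall>Q. chain S (length ps) l Q \<longrightarrow> c \<le> chain_cost A ps v Q)) \<and>
     (\<forall>l Q. chain S (length ps) l Q \<longrightarrow> (\<exists>c qs. (l, c, qs) \<in> set row))"

lemma chain_snoc:
  "chain S (Suc k) l (Q @ [l']) \<longleftrightarrow> l' = l \<and> l \<in> set S \<and> Q ! k \<le> l \<and> chain S k (Q ! k) Q"
  if "length Q = Suc k"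
  using that
  by (auto simp: chain_def nth_append sorted_append in_set_conv_nth sorted_iff_nth_mono)
     (metis le_trans less_Suc_eq_le lessI)

lemma chain_cost_snoc:
  "chain_cost A (ps @ [p]) v (Q @ [l]) =
     chain_cost A ps v Q + A p (slice (Q ! length ps) l v)"
  if "length Q = Suc (length ps)"
  using that by (simp add: chain_cost_def nth_append)

lemma dp_entry_comp_ok:
  assumes row: "row_ok A v S ps row" and e: "(e, t) \<in> dp_entry_comp A tA p v row l"
    and l: "l \<in> set S"
  shows "\<exists>c qs. e = (l, c, qs) \<and> chain S (Suc (length ps)) l (rev qs) \<and>
           c = chain_cost A (ps @ [p]) v (rev qs) \<and>
           (\<forall>Q. chain S (Suc (length ps)) l Q \<longrightarrow> c \<le> chain_cost A (ps @ [p]) v Q)"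
proof -
  define g where
    "g = (\<lambda>(l', c, qs). (l, c + A p (slice l' l v), l # qs) :: dp_entry)"
  let ?F = "\<lambda>(l', c, qs). tick (l - l' + 1)
             (blackbox_comp A tA p (slice l' l v) \<triangleright> (\<lambda>a. ret (l, c + a, l # qs)))"
  have F: "y = g x" if "(y, s) \<in> ?F x" for x y s
    using that by (auto simp: g_def tick_def bind_comp_def ret_def blackbox_comp_def split: prod.splits)
  obtain es s where es: "(es, s) \<in> mapM_comp ?F (filter (\<lambda>e. fst e \<le> l) row)"
    and e1: "e \<in> set es" and e2: "\<forall>e'\<in>set es. fst (snd e) \<le> fst (snd e')"
    using e unfolding dp_entry_comp_def tick_def bind_comp_def[of "mapM_comp _ _"] cheapest_comp_def
    by auto
  have "list_all2 (\<lambda>x y. y = g x) (filter (\<lambda>e. fst e \<le> l) row) es"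
    using mapM_comp_all2[OF es] F by (auto elim!: list_all2_mono)
  then have "es = map g (filter (\<lambda>e. fst e \<le> l) row)"
    by (simp add: list_all2_conv_all_nth list_eq_iff_nth_eq)
  then have set_es: "set es = g ` {x \<in> set row. fst x \<le> l}" by simp
  then obtain l' c' qs' where x: "(l', c', qs') \<in> set row" "l' \<le> l" and e_eq: "e = g (l', c', qs')"
    using e1 by auto
  have ch: "chain S (length ps) l' (rev qs')" and c': "c' = chain_cost A ps v (rev qs')"
    using row x(1) unfolding row_ok_def by blast+
  have len: "length (rev qs') = Suc (length ps)" and last: "rev qs' ! length ps = l'"
    using ch by (simp_all add: chain_def)
  have "chain S (Suc (length ps)) l (rev (l # qs'))"
    using chain_snoc[OF len, of S l l] ch last l x(2) by simp
  moreover have "c' + A p (slice l' l v) = chain_cost A (ps @ [p]) v (rev (l # qs'))"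
    using chain_cost_snoc[OF len, of A p v l] c' last by simp
  moreover have "c' + A p (slice l' l v) \<le> chain_cost A (ps @ [p]) v Q"
    if Q: "chain S (Suc (length ps)) l Q" for Q
  proof -
    have "length Q = Suc (Suc (length ps))" using Q by (simp add: chain_def)
    then obtain R z where R: "Q = R @ [z]" and lR: "length R = Suc (length ps)"
      by (metis length_Suc_conv_rev)
    have z: "z = l" and Rl: "R ! length ps \<le> l" and chR: "chain S (length ps) (R ! length ps) R"
      using Q chain_snoc[OF lR, of S l z] R by auto
    obtain c qs where cq: "(R ! length ps, c, qs) \<in> set row"
      using row chR unfolding row_ok_def by blast
    have "c \<le> chain_cost A ps v R"
      using row cq chR unfolding row_ok_def by blast
    moreover have "g (R ! length ps, c, qs) \<in> set es" using set_es cq Rl by auto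
    then have "fst (snd e) \<le> fst (snd (g (R ! length ps, c, qs)))" using e2 by blast
    ultimately show ?thesis
      using chain_cost_snoc[OF lR, of A p v l] by (simp add: e_eq g_def R z)
  qed
  ultimately show ?thesis by (auto simp: e_eq g_def)
qed

lemma dp_rows_comp_ok:
  assumes "row_ok A v S ps0 row" and "(row', t) \<in> dp_rows_comp A tA v S ps row"
  shows "row_ok A v S (ps0 @ ps) row'"
  using assms
proof (induction ps arbitrary: ps0 row t)
  case Nil
  then show ?case by (simp add: ret_def)
next
  case (Cons p ps)
  obtain mid s1 s2 where mid: "(mid, s1) \<in> mapM_comp (dp_entry_comp A tA p v row) S"
    and rest: "(row', s2) \<in> dp_rows_comp A tA v S ps mid"
    using Cons.prems(2) by (auto simp: bind_comp_def)
  have all2: "list_all2 (\<lambda>l e. \<exists>s. (e, s) \<in> dp_entry_comp A tA p v row l) S mid"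
    by (rule mapM_comp_all2[OF mid])
  have "row_ok A v S (ps0 @ [p]) mid"
    unfolding row_ok_def
  proof (intro conjI allI impI ballI)
    fix e assume "e \<in> set mid"
    then obtain i where i: "i < length mid" "mid ! i = e" by (auto simp: in_set_conv_nth)
    then have l: "S ! i \<in> set S" using list_all2_lengthD[OF all2] by simp
    obtain s where e: "(e, s) \<in> dp_entry_comp A tA p v row (S ! i)"
      using list_all2_nthD2[OF all2 i(1)] i(2) by auto
    show "case e of (l, c, qs) \<Rightarrow> chain S (length (ps0 @ [p])) l (rev qs) \<and>
        c = chain_cost A (ps0 @ [p]) v (rev qs) \<and>
        (\<forall>Q. chain S (length (ps0 @ [p])) l Q \<longrightarrow> c \<le> chain_cost A (ps0 @ [p]) v Q)"
      using dp_entry_comp_ok[OF Cons.prems(1) e l] by auto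
  next
    fix l Q assume Q: "chain S (length (ps0 @ [p])) l Q"
    then have l: "l \<in> set S" unfolding chain_def
      by (metis lessI nth_mem subsetD)
    then obtain i where i: "i < length S" "S ! i = l" by (auto simp: in_set_conv_nth)
    then have "mid ! i \<in> set mid" using list_all2_lengthD[OF all2] by simp
    moreover obtain s where e: "(mid ! i, s) \<in> dp_entry_comp A tA p v row l"
      using list_all2_nthD[OF all2 i(1)] i(2) by auto
    ultimately show "\<exists>c qs. (l, c, qs) \<in> set mid"
      using dp_entry_comp_ok[OF Cons.prems(1) e l] by metis
  qed
  from Cons.IH[OF this rest] show ?case by simp
qed

lemma partition_comp_minimizer:
  assumes "(Q, t) \<in> partition_comp A tA ps v S" and "0 \<in> set S"
  shows "chain S (length ps) (length v) Q"
    and "chain S (length ps) (length v) Q' \<Longrightarrow> chain_cost A ps v Q \<le> chain_cost A ps v Q'"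
proof -
  have "row_ok A v S [] [(0, 0, [0])]"
    using assms(2) by (auto simp: row_ok_def chain_def chain_cost_def)
  moreover obtain row s c qs where "(row, s) \<in> dp_rows_comp A tA v S ps [(0, 0, [0])]"
    and q: "(length v, c, qs) \<in> set row" "Q = rev qs"
    using assms(1) unfolding partition_comp_def bind_comp_def by auto
  ultimately have "row_ok A v S ps row" using dp_rows_comp_ok by fastforce
  then show "chain S (length ps) (length v) Q"
    and "chain S (length ps) (length v) Q' \<Longrightarrow> chain_cost A ps v Q \<le> chain_cost A ps v Q'"
    using q unfolding row_ok_def by blast+
qed

text \<open>
  The alignments of the parts are executed from left to right. When the \<open>i\<close>-th one starts,
  its part is preceded by the first \<open>q\<^bsub>i-1\<^esub>\<close> characters of \<open>v\<close>.
\<close>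

definition join_alignments :: "nat list \<Rightarrow> 'a edit list list \<Rightarrow> 'a edit list" where
  "join_alignments Q ess = concat (map2 (\<lambda>q es. map (shift_edit q) es) Q ess)"

lemma equipartition_parts_shorter:
  assumes "(P, t) \<in> equipartition_comp m u" and "\<not> length u \<le> 1" and "p \<in> set (parts P u)"
  shows "length p < length u"
proof -
  have m: "2 \<le> m" and P: "is_equipartition m u P"
    using assms(1) by (auto simp: equipartition_comp_def)
  have len: "length P = m + 1"
    using P by (simp add: is_equipartition_def is_partition_def)
  obtain i where i: "i < m" and p: "p = slice (P ! i) (P ! Suc i) u"
    using assms(3) len by (auto simp: parts_def set_zip nth_tl)
  have u2: "length u \<ge> 2" using assms(2) by simp
  have "real (length u) / real m \<le> real (length u) / 2"
    using m by (intro divide_left_mono) auto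
  also have "\<dots> \<le> real_of_int (int (length u) - 1)" using u2 by simp
  finally have bd: "real (length u) / real m \<le> real_of_int (int (length u) - 1)" .
  have "\<lceil>real (length u) / real m\<rceil> \<le> int (length u) - 1"
    using bd by (rule ceiling_le)
  moreover have "\<lfloor>real (length u) / real m\<rfloor> \<le> \<lceil>real (length u) / real m\<rceil>"
    by (rule floor_le_ceiling)
  moreover have "int (P ! Suc i - P ! i) = \<lfloor>real (length u) / real m\<rfloor> \<or>
      int (P ! Suc i - P ! i) = \<lceil>real (length u) / real m\<rceil>"
    using P i unfolding is_equipartition_def by blast
  ultimately have "int (P ! Suc i - P ! i) \<le> int (length u) - 1"
    by (metis order_trans)
  moreover have "length p \<le> P ! Suc i - P ! i" by (simp add: p slice_def)
  ultimately show ?thesis using u2 by linarith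
qed

function algorithm_B ::
  "nat \<Rightarrow> ('a list \<Rightarrow> 'a list \<Rightarrow> real) \<Rightarrow> ('a list \<Rightarrow> 'a list \<Rightarrow> nat) \<Rightarrow>
   'a list \<Rightarrow> 'a list \<Rightarrow> 'a edit list comp" where
  "algorithm_B m A tA u v =
     (if length u \<le> 1 then base_comp u v
      else
        equipartition_comp m u \<triangleright> (\<lambda>P.
        candidates_comp m P (length u) (length v) \<triangleright> (\<lambda>S.
        tick (length u + m) (partition_comp A tA (parts P u) v S) \<triangleright> (\<lambda>Q.
        tick (length v + m)
          (mapM_comp (\<lambda>(p, q). algorithm_B m A tA p q) (zip (parts P u) (parts Q v))) \<triangleright> (\<lambda>ess.
        tick (length (concat ess) + m) (ret (join_alignments Q ess)))))))"
  by pat_completeness auto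
termination
  by (relation "measure (\<lambda>(m, A, tA, u, v). length u)")
     (auto dest: equipartition_parts_shorter set_zip_leftD)

declare algorithm_B.simps [simp del]

end

theory Submission
  imports Defs
begin

text \<open>
  Cutting an optimal alignment at the positions of \<open>P\<close> gives a partition \<open>q\<close> of \<open>v\<close> whose
  parts have total edit distance at most \<open>\<Delta> = edit_dist u v\<close> to the parts of \<open>u\<close>, and
  \<open>\<bar>q i - P ! i\<bar> \<le> \<Delta>\<close>. Rounding every \<open>q i\<close> down to a candidate moves it by at most
  \<open>\<bar>q i - P ! i\<bar> / m\<close>, because the candidate distances grow by the factor \<open>1 + 1/m\<close>; this
  changes the total cost by at most \<open>2 m \<cdot> \<Delta>/m\<close>. So some admissible partition costs at most
  \<open>3\<Delta>\<close>, and the one chosen through the black box at most \<open>3 \<gamma>(n) \<Delta>\<close>. This factor is paid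
  once per level, and a string \<open>u\<close> with \<open>length u \<le> m ^ h\<close> needs \<open>h\<close> levels.

  A node of the recursion costs \<open>O(m R\<^sup>2 T)\<close> steps for \<open>R = O(m\<^sup>2 log n)\<close> candidates, where
  superadditivity of \<open>T\<close> bounds the sum over a level; and \<open>T n \<ge> n\<close>, so linear overheads
  are absorbed.
\<close>

section \<open>Edit distance of concatenations\<close>

lemma alignment_append:
  "alignment (es @ fs) x z \<longleftrightarrow> (\<exists>y. alignment es x y \<and> alignment fs y z)"
  by (induction es arbitrary: x) auto

lemma apply_shift_edit:
  assumes "apply_edit e x = Some y"
  shows "apply_edit (shift_edit (length w) e) (w @ x @ z) = Some (w @ y @ z)"
  using assms by (cases e) (auto simp: list_update_append split: if_splits)

lemma alignment_shift:
  "alignment es x y \<Longrightarrow> alignment (map (shift_edit (length w)) es) (w @ x @ z) (w @ y @ z)"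
  by (induction es arbitrary: x) (auto dest: apply_shift_edit)

lemma alignment_delete_all: "alignment (replicate (length x) (Del 0)) x []"
  by (induction x) auto

text \<open>All insertions happen at the front, so the last character of \<open>y\<close> has to
  come first.\<close>

lemma alignment_insert_all: "alignment (map (Ins 0) (rev y)) [] y"
  by (induction y) (auto simp: alignment_append)

text \<open>Erase \<open>x\<close>, then write \<open>y\<close> from scratch. Besides the crude
  bound, this shows that the \<open>LEAST\<close> in \<open>edit_dist\<close> is attained.\<close>

lemma ex_alignment: "\<exists>es. alignment es x y \<and> length es = length x + length y"
proof (intro exI conjI)
  show "alignment (replicate (length x) (Del 0) @ map (Ins 0) (rev y)) x y"
    unfolding alignment_append using alignment_delete_all alignment_insert_all by blast
qed simp

lemma edit_dist_le: "alignment es x y \<Longrightarrow> edit_dist x y \<le> length es"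
  unfolding edit_dist_def by (rule Least_le) blast

lemma ex_optimal_alignment: "\<exists>es. alignment es x y \<and> length es = edit_dist x y"
  unfolding edit_dist_def using ex_alignment[of x y] by (rule LeastI2_ex[OF exI]) blast+

lemma edit_dist_le_length: "edit_dist x y \<le> length x + length y"
  using ex_alignment[of x y] edit_dist_le by metis

lemma edit_dist_refl [simp]: "edit_dist x x = 0"
  using edit_dist_le[of "[]" x x] by simp

lemma edit_dist_triangle: "edit_dist x z \<le> edit_dist x y + edit_dist y z"
  using ex_optimal_alignment[of x y] ex_optimal_alignment[of y z] edit_dist_le[of _ x z]
  by (metis alignment_append length_append)

lemma edit_dist_append: "edit_dist (x1 @ x2) (y1 @ y2) \<le> edit_dist x1 y1 + edit_dist x2 y2"
proof -
  obtain es fs where es: "alignment es x1 y1" "length es = edit_dist x1 y1"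
    and fs: "alignment fs x2 y2" "length fs = edit_dist x2 y2"
    using ex_optimal_alignment by metis
  have "alignment (map (shift_edit 0) es @ map (shift_edit (length y1)) fs) (x1 @ x2) (y1 @ y2)"
    using alignment_shift[OF es(1), of "[]" x2] alignment_shift[OF fs(1), of y1 "[]"]
    by (auto simp: alignment_append)
  from edit_dist_le[OF this] show ?thesis using es(2) fs(2) by simp
qed

section \<open>Cutting an alignment along a cut of its source string\<close>

lemma alignment_length_diff:
  "alignment es x y \<Longrightarrow> length x \<le> length y + length es \<and> length y \<le> length x + length es"
proof (induction es arbitrary: x)
  case (Cons e es)
  then obtain z where z: "apply_edit e x = Some z" "alignment es z y" by auto
  have "length x \<le> length z + 1 \<and> length z \<le> length x + 1"
    using z(1) by (cases e) (auto split: if_splits)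
  with Cons.IH[OF z(2)] show ?case by simp
qed simp

lemma abs_length_diff_le_edit_dist: "\<bar>int (length x) - int (length y)\<bar> \<le> int (edit_dist x y)"
  using ex_optimal_alignment[of x y] alignment_length_diff[of _ x y] by fastforce

text \<open>A single edit touches only one side of the cut. An insertion exactly at the boundary
  could go to either side; it is assigned to the left factor.\<close>

lemma apply_edit_append:
  assumes "apply_edit e (x1 @ x2) = Some y"
  shows "\<exists>y1 y2. y = y1 @ y2 \<and>
    (x1 = y1 \<and> (\<exists>e'. apply_edit e' x2 = Some y2) \<or> x2 = y2 \<and> (\<exists>e'. apply_edit e' x1 = Some y1))"
proof (cases e)
  case (Ins i c)
  show ?thesis
  proof (cases "i \<le> length x1")
    case True
    then have "apply_edit (Ins i c) x1 = Some (take i x1 @ c # drop i x1)"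
      "y = (take i x1 @ c # drop i x1) @ x2" using Ins assms by auto
    then show ?thesis by blast
  next
    case False
    let ?i = "i - length x1"
    have "apply_edit (Ins ?i c) x2 = Some (take ?i x2 @ c # drop ?i x2)"
      "y = x1 @ (take ?i x2 @ c # drop ?i x2)" using Ins assms False by (auto split: if_splits)
    then show ?thesis by blast
  qed
next
  case (Del i)
  show ?thesis
  proof (cases "i < length x1")
    case True
    then have "apply_edit (Del i) x1 = Some (take i x1 @ drop (Suc i) x1)"
      "y = (take i x1 @ drop (Suc i) x1) @ x2" using Del assms by auto
    then show ?thesis by blast
  next
    case False
    let ?i = "i - length x1"
    have "apply_edit (Del ?i) x2 = Some (take ?i x2 @ drop (Suc ?i) x2)"
      "y = x1 @ (take ?i x2 @ drop (Suc ?i) x2)"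
      using Del assms False by (auto split: if_splits simp: Suc_diff_le)
    then show ?thesis by blast
  qed
next
  case (Sub i c)
  show ?thesis
  proof (cases "i < length x1")
    case True
    then have "apply_edit (Sub i c) x1 = Some (x1[i := c])"
      "y = x1[i := c] @ x2" using Sub assms by (auto simp: list_update_append)
    then show ?thesis by blast
  next
    case False
    let ?i = "i - length x1"
    have "apply_edit (Sub ?i c) x2 = Some (x2[?i := c])"
      "y = x1 @ x2[?i := c]" using Sub assms False
      by (auto split: if_splits simp: list_update_append)
    then show ?thesis by blast
  qed
qed

text \<open>The cut travels along with the edits. Each edit is charged to the one factor that it
  changes, so the two lengths add up exactly.\<close>

lemma alignment_split:
  assumes "alignment es (x1 @ x2) y"
  shows "\<exists>y1 y2 es1 es2. y = y1 @ y2 \<and> alignment es1 x1 y1 \<and> alignment es2 x2 y2 \<and>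
    length es1 + length es2 = length es"
  using assms
proof (induction es arbitrary: x1 x2)
  case Nil
  then show ?case by (metis add_0 alignment.simps(1) list.size(3))
next
  case (Cons e es)
  then obtain z where z: "apply_edit e (x1 @ x2) = Some z" "alignment es z y" by auto
  obtain z1 z2 where z12: "z = z1 @ z2"
    and step: "x1 = z1 \<and> (\<exists>e'. apply_edit e' x2 = Some z2) \<or>
               x2 = z2 \<and> (\<exists>e'. apply_edit e' x1 = Some z1)"
    using apply_edit_append[OF z(1)] by blast
  obtain y1 y2 es1 es2 where y: "y = y1 @ y2"
    and al: "alignment es1 z1 y1" "alignment es2 z2 y2"
    and len: "length es1 + length es2 = length es"
    using Cons.IH z(2) z12 by blast
  from step show ?case
  proof
    assume "x1 = z1 \<and> (\<exists>e'. apply_edit e' x2 = Some z2)"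
    then obtain e' where "x1 = z1" "apply_edit e' x2 = Some z2" by blast
    then show ?case using y al len
      by (intro exI[of _ y1] exI[of _ y2] exI[of _ es1] exI[of _ "e' # es2"]) auto
  next
    assume "x2 = z2 \<and> (\<exists>e'. apply_edit e' x1 = Some z1)"
    then obtain e' where "x2 = z2" "apply_edit e' x1 = Some z1" by blast
    then show ?case using y al len
      by (intro exI[of _ y1] exI[of _ y2] exI[of _ "e' # es1"] exI[of _ es2]) auto
  qed
qed

text \<open>Obtained by cutting an optimal alignment. It reverses the inequality
  \<open>edit_dist_append\<close> for a suitable cut of \<open>y\<close>.\<close>

lemma edit_dist_split:
  "\<exists>y1 y2. y = y1 @ y2 \<and> edit_dist x1 y1 + edit_dist x2 y2 \<le> edit_dist (x1 @ x2) y"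
proof -
  obtain es where es: "alignment es (x1 @ x2) y" "length es = edit_dist (x1 @ x2) y"
    using ex_optimal_alignment by blast
  show ?thesis
    using alignment_split[OF es(1)] es(2) edit_dist_le by (metis add_mono)
qed

section \<open>Substrings of a fixed string\<close>

lemma length_slice: "b \<le> length u \<Longrightarrow> length (slice a b u) = b - a"
  by (simp add: slice_def)

lemma slice_append: "a \<le> b \<Longrightarrow> b \<le> c \<Longrightarrow> slice a b u @ slice b c u = slice a c u"
  using take_add[of "b - a" "c - b" "drop a u"] by (simp add: slice_def)

text \<open>Moving both ends of a window to the left drops \<open>b - b'\<close> characters on the
  right and adds \<open>a - a'\<close> on the left. If \<open>b' < a\<close>, rewriting the whole
  window is cheap enough, since then \<open>b - a < b - b'\<close> and
  \<open>b' - a' < a - a'\<close>.\<close>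

lemma edit_dist_slice:
  assumes "a' \<le> a" "b' \<le> b" "a' \<le> b'" "a \<le> b" "b \<le> length v"
  shows "edit_dist (slice a b v) (slice a' b' v) \<le> (a - a') + (b - b')"
proof (cases "a \<le> b'")
  case True
  have "slice a' b' v = slice a' a v @ slice a b' v" "slice a b v = slice a b' v @ slice b' b v"
    using assms True by (simp_all add: slice_append)
  then have "edit_dist (slice a b v) (slice a' b' v) \<le>
      edit_dist (slice a b v) (slice a b' v) + edit_dist (slice a b' v) (slice a' b' v)"
    using edit_dist_triangle by blast
  moreover have "edit_dist (slice a b v) (slice a b' v) \<le> b - b'"
    using edit_dist_append[of "slice a b' v" "slice b' b v" "slice a b' v" "[]"]
      edit_dist_le_length[of "slice b' b v" "[]"] assms True
    by (simp add: slice_append length_slice)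
  moreover have "edit_dist (slice a b' v) (slice a' b' v) \<le> a - a'"
    using edit_dist_append[of "[]" "slice a b' v" "slice a' a v" "slice a b' v"]
      edit_dist_le_length[of "[]" "slice a' a v"] assms True
    by (simp add: slice_append length_slice)
  ultimately show ?thesis by simp
next
  case False
  then show ?thesis
    using edit_dist_le_length[of "slice a b v" "slice a' b' v"] assms by (simp add: length_slice)
qed

section \<open>Partitions and joined alignments\<close>

lemma length_parts [simp]: "length (parts P u) = length P - 1"
  by (simp add: parts_def)

lemma nth_parts: "Suc i < length P \<Longrightarrow> parts P u ! i = slice (P ! i) (P ! Suc i) u"
  by (simp add: parts_def nth_tl)

lemma parts_Cons_Cons [simp]: "parts (a # b # P) u = slice a b u # parts (b # P) u"
  by (simp add: parts_def)

lemma parts_singleton [simp]: "parts [a] u = []"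
  by (simp add: parts_def)

lemma take_slice: "a \<le> b \<Longrightarrow> take a u @ slice a b u = take b u"
  using slice_append[of 0 a b u] by (simp add: slice_def)

text \<open>The prefix \<open>take a u\<close> allows the induction to start at an arbitrary first
  cut.\<close>

lemma take_concat_parts:
  "sorted (a # P) \<Longrightarrow> take a u @ concat (parts (a # P) u) = take (last (a # P)) u"
proof (induction P arbitrary: a)
  case (Cons b P)
  then show ?case using take_slice[of a b u] by (simp del: last.simps flip: append_assoc) simp
qed simp

lemma partition_Cons:
  assumes "is_partition m u P"
  obtains P' where "P = 0 # P'" "length P' = m" "sorted (0 # P')" "last (0 # P') = length u"
proof -
  have P: "length P = m + 1" "P ! 0 = 0" "sorted P" "P ! m = length u"
    using assms by (auto simp: is_partition_def)
  then obtain a P' where P': "P = a # P'" by (cases P) auto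
  have "last P = length u" using P P' by (subst last_conv_nth) auto
  then show thesis using that[of P'] P P' by auto
qed

lemma concat_parts: "is_partition m u P \<Longrightarrow> concat (parts P u) = u"
  by (metis append_Nil take_concat_parts order_refl partition_Cons take0 take_all)

lemma partition_mono:
  "is_partition m u P \<Longrightarrow> i \<le> j \<Longrightarrow> j \<le> m \<Longrightarrow> P ! i \<le> P ! j"
  by (auto simp: is_partition_def intro: sorted_nth_mono)

lemma partition_le_length: "is_partition m u P \<Longrightarrow> i \<le> m \<Longrightarrow> P ! i \<le> length u"
  using partition_mono[of m u P i m] by (auto simp: is_partition_def)

lemma sum_length_parts:
  assumes "is_partition m u P"
  shows "(\<Sum>i<m. length (parts P u ! i)) = length u"
proof -
  have "length (parts P u) = m" using assms by (simp add: is_partition_def)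
  then have "(\<Sum>i<m. length (parts P u ! i)) = sum_list (map length (parts P u))"
    by (simp add: sum_list_sum_nth lessThan_atLeast0)
  then show ?thesis using concat_parts[OF assms] by (metis length_concat)
qed

text \<open>Invariant of the execution from left to right: the first \<open>a\<close> characters of
  \<open>v\<close> are finished, while the parts \<open>ps\<close> of the source are still
  untouched.\<close>

lemma alignment_join_from:
  assumes "sorted (a # Q)" "last (a # Q) \<le> length v"
    and "list_all2 (\<lambda>(p, q) es. alignment es p q) (zip ps (parts (a # Q) v)) ess"
    and "length ps = length Q"
  shows "alignment (join_alignments (a # Q) ess) (take a v @ concat ps) (take (last (a # Q)) v)"
  using assms
proof (induction Q arbitrary: a ps ess)
  case Nil
  then show ?case by (simp add: join_alignments_def)
next
  case (Cons b Q)
  obtain p ps' where ps: "ps = p # ps'" using Cons.prems(4) by (cases ps) auto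
  obtain es ess' where ess: "ess = es # ess'" using Cons.prems(3) ps by (auto simp: list_all2_Cons1)
  have ab: "a \<le> b" using Cons.prems(1) by simp
  have "b \<le> last (b # Q)" using Cons.prems(1) last_in_set[of Q] by auto
  then have aL: "a \<le> length v" using ab Cons.prems(2) by simp
  have "alignment es p (slice a b v)" using Cons.prems(3) ps ess by simp
  from alignment_shift[OF this, of "take a v" "concat ps'"]
  have "alignment (map (shift_edit a) es) (take a v @ concat ps) (take b v @ concat ps')"
    using aL ps take_slice[OF ab, of v] by (simp add: min_absorb2 flip: append_assoc)
  moreover have "alignment (join_alignments (b # Q) ess') (take b v @ concat ps') (take (last (b # Q)) v)"
    using Cons.prems ps ess by (intro Cons.IH) auto
  ultimately show ?case
    by (auto simp: join_alignments_def ess alignment_append)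
qed

lemma alignment_join:
  assumes P: "is_partition m u P" and Q: "is_partition m v Q" and "length ess = m"
    and es: "\<And>i. i < m \<Longrightarrow> alignment (ess ! i) (parts P u ! i) (parts Q v ! i)"
  shows "alignment (join_alignments Q ess) u v"
proof -
  obtain Q' where Q': "Q = 0 # Q'" "length Q' = m" "sorted (0 # Q')" "last (0 # Q') = length v"
    using partition_Cons[OF Q] by metis
  have "length (parts P u) = m" using P by (simp add: is_partition_def)
  then have "alignment (join_alignments Q ess) (take 0 v @ concat (parts P u)) (take (length v) v)"
    using alignment_join_from[of 0 Q' v "parts P u" ess] Q' es \<open>length ess = m\<close>
    by (auto simp: list_all2_conv_all_nth)
  then show ?thesis using concat_parts[OF P] by simp
qed

lemma length_join_alignments:
  assumes "length ess \<le> length Q"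
  shows "length (join_alignments Q ess) = sum_list (map length ess)"
  using assms unfolding join_alignments_def
proof (induction ess arbitrary: Q)
  case (Cons es ess)
  then show ?case by (cases Q) auto
qed simp

lemma ex_equipartition:
  assumes "0 < m"
  shows "\<exists>P. is_equipartition m u P"
proof -
  let ?L = "length u"
  define a where "a = ?L div m"
  define r where "r = ?L mod m"
  \<comment> \<open>The first \<open>r\<close> parts have size \<open>a + 1\<close>, the others have
    size \<open>a\<close>.\<close>
  define P where "P = map (\<lambda>i. i * a + min i r) [0..<m + 1]"
  have L: "?L = m * a + r" and r: "r < m"
    using assms by (simp_all add: a_def r_def)
  have nth: "P ! i = i * a + min i r" if "i \<le> m" for i
    using that unfolding P_def by (subst nth_map) (auto simp del: upt_Suc)
  have len: "length P = m + 1" by (simp add: P_def)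
  have "sorted P"
    unfolding sorted_iff_nth_mono using nth len by (auto intro!: add_mono mult_right_mono)
  then have part: "is_partition m u P"
    unfolding is_partition_def using nth[of 0] nth[of m] len L r by simp
  have fl: "\<lfloor>real ?L / real m\<rfloor> = int a"
    by (simp add: a_def floor_divide_of_nat_eq)
  have ce: "\<lceil>real ?L / real m\<rceil> = int a + 1" if "0 < r"
  proof -
    have "real ?L = real m * real a + real r" by (simp add: L)
    then show ?thesis using that r assms by (intro ceiling_unique) (auto simp: field_simps)
  qed
  have "int (P ! Suc i - P ! i) \<in> {\<lfloor>real ?L / real m\<rfloor>, \<lceil>real ?L / real m\<rceil>}" if "i < m" for i
  proof (cases "i < r")
    case True
    then show ?thesis using nth[of i] nth[of "Suc i"] that ce by simp
  next
    case False
    then show ?thesis using nth[of i] nth[of "Suc i"] that fl by simp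
  qed
  then show ?thesis using part unfolding is_equipartition_def by blast
qed

text \<open>Passing to a part lowers the exponent by one. Rounding \<open>length u / m\<close> up
  does no harm because \<open>m ^ h\<close> is an integer.\<close>

lemma length_equipartition_part:
  assumes "is_equipartition m u P" "length u \<le> m ^ Suc h" "i < m"
  shows "length (parts P u ! i) \<le> m ^ h"
proof -
  have P: "is_partition m u P" using assms(1) by (simp add: is_equipartition_def)
  have "real (length u) / real m \<le> real (m ^ h)"
    using assms(2,3) by (simp add: divide_le_eq mult.commute flip: of_nat_mult of_nat_power)
  then have "\<lceil>real (length u) / real m\<rceil> \<le> int (m ^ h)" by (simp add: ceiling_le_iff)
  moreover have "\<lfloor>real (length u) / real m\<rfloor> \<le> \<lceil>real (length u) / real m\<rceil>"
    by (rule floor_le_ceiling)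
  moreover have "int (P ! Suc i - P ! i)
      \<in> {\<lfloor>real (length u) / real m\<rfloor>, \<lceil>real (length u) / real m\<rceil>}"
    using assms(1,3) unfolding is_equipartition_def by blast
  ultimately have "int (P ! Suc i - P ! i) \<le> int (m ^ h)"
    by (metis insertE order_trans singletonD)
  moreover have "length (parts P u ! i) = P ! Suc i - P ! i"
    using P assms(3) partition_le_length[OF P, of "Suc i"]
    by (simp add: nth_parts length_slice is_partition_def)
  ultimately show ?thesis by linarith
qed

section \<open>Rounding an optimal partition\<close>

text \<open>The parts of \<open>u\<close> are split off one by one from the left with
  \<open>edit_dist_split\<close>. The cuts of \<open>v\<close> are kept as a function, which is
  extended by updates.\<close>

lemma ex_optimal_partition:
  assumes "is_partition (Suc m) u P"
  shows "\<exists>q. q 0 = 0 \<and> (\<forall>i\<le>m. q i \<le> q (Suc i)) \<and> q (Suc m) = length v \<and>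
    (\<Sum>i\<le>m. edit_dist (parts P u ! i) (slice (q i) (q (Suc i)) v)) \<le> edit_dist u v"
proof -
  have P: "length P = Suc (Suc m)" "P ! 0 = 0" "P ! Suc m = length u"
    using assms by (auto simp: is_partition_def)
  \<comment> \<open>Invariant: the cost of the first \<open>k\<close> parts plus the distance of the
    two remaining suffixes is at most \<open>edit_dist u v\<close>. The last part is treated
    separately, since its right end must be \<open>length v\<close>.\<close>
  have "\<exists>q. q 0 = 0 \<and> (\<forall>i<k. q i \<le> q (Suc i)) \<and> q k \<le> length v \<and>
    (\<Sum>i<k. edit_dist (parts P u ! i) (slice (q i) (q (Suc i)) v)) +
      edit_dist (drop (P ! k) u) (drop (q k) v) \<le> edit_dist u v" if "k \<le> m" for k
    using that
  proof (induction k)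
    case 0
    then show ?case using P by (intro exI[of _ "\<lambda>_. 0"]) simp
  next
    case (Suc k)
    then obtain q where q: "q 0 = 0" "\<forall>i<k. q i \<le> q (Suc i)" "q k \<le> length v"
      "(\<Sum>i<k. edit_dist (parts P u ! i) (slice (q i) (q (Suc i)) v)) +
        edit_dist (drop (P ! k) u) (drop (q k) v) \<le> edit_dist u v" by auto
    have "P ! k \<le> P ! Suc k" using Suc partition_mono[OF assms] by simp
    then have "drop (P ! k) u = parts P u ! k @ drop (P ! Suc k) u"
      using Suc.prems P append_take_drop_id[of "P ! Suc k - P ! k" "drop (P ! k) u"]
      by (simp add: nth_parts slice_def)
    then obtain y1 y2 where y: "drop (q k) v = y1 @ y2"
      "edit_dist (parts P u ! k) y1 + edit_dist (drop (P ! Suc k) u) y2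
        \<le> edit_dist (drop (P ! k) u) (drop (q k) v)"
      using edit_dist_split[where y = "drop (q k) v"] by metis
    define l where "l = q k + length y1"
    have l: "slice (q k) l v = y1" "drop l v = y2" "l \<le> length v"
    proof -
      show "slice (q k) l v = y1" by (simp add: slice_def l_def y(1))
      have "drop (length y1) (drop (q k) v) = y2" by (simp add: y(1))
      then show "drop l v = y2" by (simp add: l_def add.commute)
      have "length (drop (q k) v) = length y1 + length y2" by (simp add: y(1))
      then show "l \<le> length v" using q(3) by (simp add: l_def)
    qed
    show ?case
    proof (intro exI[of _ "q(Suc k := l)"] conjI)
      have "(\<Sum>i<k. edit_dist (parts P u ! i) (slice ((q(Suc k := l)) i) ((q(Suc k := l)) (Suc i)) v))
        = (\<Sum>i<k. edit_dist (parts P u ! i) (slice (q i) (q (Suc i)) v))"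
        by (intro sum.cong) auto
      then show "(\<Sum>i<Suc k. edit_dist (parts P u ! i)
            (slice ((q(Suc k := l)) i) ((q(Suc k := l)) (Suc i)) v)) +
          edit_dist (drop (P ! Suc k) u) (drop ((q(Suc k := l)) (Suc k)) v) \<le> edit_dist u v"
        using y(2) q(4) l by simp
    qed (use q l in \<open>auto simp: l_def less_Suc_eq\<close>)
  qed
  from this[of m] obtain q where q: "q 0 = 0" "\<forall>i<m. q i \<le> q (Suc i)" "q m \<le> length v"
      "(\<Sum>i<m. edit_dist (parts P u ! i) (slice (q i) (q (Suc i)) v)) +
        edit_dist (drop (P ! m) u) (drop (q m) v) \<le> edit_dist u v" by auto
  have last: "parts P u ! m = drop (P ! m) u"
    using P by (simp add: nth_parts slice_def)
  show ?thesis
  proof (intro exI[of _ "q(Suc m := length v)"] conjI)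
    have "(\<Sum>i<m. edit_dist (parts P u ! i)
        (slice ((q(Suc m := length v)) i) ((q(Suc m := length v)) (Suc i)) v))
      = (\<Sum>i<m. edit_dist (parts P u ! i) (slice (q i) (q (Suc i)) v))"
      by (intro sum.cong) auto
    then show "(\<Sum>i\<le>m. edit_dist (parts P u ! i)
        (slice ((q(Suc m := length v)) i) ((q(Suc m := length v)) (Suc i)) v)) \<le> edit_dist u v"
      using q(4) last by (simp add: slice_def lessThan_Suc_atMost[symmetric])
  qed (use q in \<open>auto simp: le_less\<close>)
qed

text \<open>With \<open>b = 1 + 1/m\<close> and \<open>d\<close> the distance of \<open>q\<close>
  and \<open>p\<close>, choose \<open>j\<close> with \<open>b ^ j \<le> d < b ^ Suc j\<close>. The
  candidate below \<open>q\<close> comes from \<open>p + b ^ j\<close> if \<open>p < q\<close> and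
  from \<open>p - b ^ Suc j\<close> if \<open>q < p\<close>. Either way the gap is at most
  \<open>b ^ Suc j - b ^ j = b ^ j / m \<le> d / m\<close>; the ceiling only shrinks it and does not
  pass the integer \<open>q\<close>.\<close>

lemma candidate_below:
  assumes m: "0 < m" and p: "p \<in> set P" and P0: "0 \<in> set P" and q: "q \<le> L"
  shows "\<exists>s\<in>candidates m P L. s \<le> q \<and> real m * (real q - real s) \<le> \<bar>real q - real p\<bar>"
proof (cases "q = p")
  case True
  then have "p \<in> candidates m P L" using p q by (simp add: candidates_def)
  then show ?thesis using True by (intro bexI[of _ p]) auto
next
  case False
  define b where "b = 1 + 1 / real m"
  define d where "d = \<bar>real q - real p\<bar>"
  have b: "1 < b" using m by (simp add: b_def)
  have d: "1 \<le> d" using False by (simp add: d_def)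
  have "\<exists>k. d < b ^ k" using real_arch_pow[OF b] .
  define k where "k = (LEAST k. d < b ^ k)"
  have k: "d < b ^ k" unfolding k_def by (rule LeastI_ex) fact
  \<comment> \<open>\<open>k\<close> is not 0, because \<open>b ^ 0 = 1 \<le> d\<close>.\<close>
  then obtain j where j: "k = Suc j" using d by (cases k) auto
  have bj: "b ^ j \<le> d" using not_less_Least[of j "\<lambda>k. d < b ^ k"] j unfolding k_def by simp
  have "real m * b ^ Suc j = real m * b ^ j + b ^ j" using m by (simp add: b_def field_simps)
  then have mb: "real m * b ^ Suc j \<le> real m * b ^ j + d" using bj by simp
  have kb: "real m * d \<le> real m * b ^ Suc j" using k j by (intro mult_left_mono) auto
  show ?thesis
  proof (cases "p < q")
    case True
    define s where "s = nat \<lceil>real p + b ^ j\<rceil>"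
    have bj0: "0 < b ^ j" using b by simp
    then have "0 \<le> real p + b ^ j" by linarith
    then have s: "int s = \<lceil>real p + b ^ j\<rceil>" by (simp add: s_def)
    have ge: "real p + b ^ j \<le> real s" using s by linarith
    have "real p + b ^ j \<le> real q" using bj True by (simp add: d_def)
    then have sq: "s \<le> q" using s by (metis ceiling_le_iff of_int_of_nat_eq of_nat_le_iff)
    then have "s \<in> candidates m P L" using s p q unfolding candidates_def b_def by auto
    moreover have "real m * (real q - real s) \<le> real m * (d - b ^ j)"
      using ge True by (intro mult_left_mono) (auto simp: d_def)
    then have "real m * (real q - real s) \<le> d" using mb kb by (simp add: right_diff_distrib)
    ultimately show ?thesis using sq by (intro bexI[of _ s]) (auto simp: d_def)
  next
    case False
    then have qp: "q < p" using \<open>q \<noteq> p\<close> by simp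
    define z where "z = \<lceil>real p - b ^ Suc j\<rceil>"
    \<comment> \<open>For negative \<open>z\<close> this is 0, which is a candidate as well and
      still lies between \<open>p - b ^ Suc j\<close> and \<open>q\<close>.\<close>
    define s where "s = nat z"
    have ge: "real p - b ^ Suc j \<le> real s" unfolding s_def z_def by linarith
    have "real p - b ^ Suc j \<le> real_of_int (int q)" using k j qp by (simp add: d_def)
    then have "z \<le> int q" unfolding z_def by (simp add: ceiling_le_iff)
    then have sq: "s \<le> q" by (simp add: s_def)
    have "s \<in> candidates m P L"
    proof (cases "0 \<le> z")
      case True
      then have "int s = \<lceil>real p - b ^ Suc j\<rceil>" by (simp add: s_def z_def)
      then have "int s \<in> {\<lceil>real p - b ^ j\<rceil> | p j. p \<in> set P}" using p by blast
      then show ?thesis using sq q unfolding candidates_def b_def by simp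
    next
      case False
      then show ?thesis using P0 by (simp add: s_def candidates_def)
    qed
    moreover have "real m * (real q - real s) \<le> real m * (b ^ Suc j - d)"
      using ge qp by (intro mult_left_mono) (auto simp: d_def)
    then have "real m * (real q - real s) \<le> d"
      using mb bj mult_left_mono[OF bj, of "real m"] by (simp add: right_diff_distrib)
    ultimately show ?thesis using sq by (intro bexI[of _ s]) (auto simp: d_def)
  qed
qed

text \<open>Of the factor 3, one unit pays for the optimal partition, one for moving the left ends
  of its parts and one for moving the right ends: each of the \<open>m\<close> ends moves by at most
  \<open>edit_dist u v / m\<close>.\<close>

lemma ex_rounded_partition:
  assumes P: "is_partition m u P" and m: "0 < m" and S: "set S = candidates m P (length v)"
  shows "\<exists>Q. chain S m (length v) Q \<and>
    (\<Sum>i<m. edit_dist (parts P u ! i) (slice (Q ! i) (Q ! Suc i) v)) \<le> 3 * edit_dist u v"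
proof -
  let ?ed = "edit_dist u v"
  have len: "length P = m + 1" and P0: "P ! 0 = 0" using P by (auto simp: is_partition_def)
  have P0': "0 \<in> set P" using len P0 by (metis nth_mem zero_less_Suc Suc_eq_plus1)
  obtain q where q: "q 0 = 0" "\<forall>i<m. q i \<le> q (Suc i)" "q m = length v"
    and cost: "(\<Sum>i<m. edit_dist (parts P u ! i) (slice (q i) (q (Suc i)) v)) \<le> ?ed"
    using ex_optimal_partition[of "m - 1" u P v] P m
    by (auto simp: less_Suc_eq_le[symmetric] lessThan_Suc_atMost[symmetric] Suc_diff_1)
  have mono: "q i \<le> q j" if "i \<le> j" "j \<le> m" for i j
    using that
  proof (induction j rule: dec_induct)
    case (step k)
    then show ?case using q(2) by (meson Suc_le_lessD le_trans less_imp_le)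
  qed simp
  have qL: "q i \<le> length v" if "i \<le> m" for i using mono[of i m] that q(3) by simp
  \<comment> \<open>The lengths of two matched parts differ by at most their edit distance, and
    these differences telescope.\<close>
  have dev: "\<bar>int (q i) - int (P ! i)\<bar> \<le> int ?ed" if "i \<le> m" for i
  proof -
    have "\<bar>int (q k) - int (P ! k)\<bar> \<le> (\<Sum>i<k. int (edit_dist (parts P u ! i) (slice (q i) (q (Suc i)) v)))"
      if "k \<le> m" for k
      using that
    proof (induction k)
      case 0
      then show ?case using q P0 by simp
    next
      case (Suc k)
      have "length (slice (q k) (q (Suc k)) v) = q (Suc k) - q k"
        using Suc.prems qL by (intro length_slice) simp
      moreover have "length (parts P u ! k) = P ! Suc k - P ! k"
        using Suc.prems len partition_le_length[OF P, of "Suc k"] by (simp add: nth_parts length_slice)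
      moreover have "q k \<le> q (Suc k)" "P ! k \<le> P ! Suc k"
        using Suc.prems q(2) partition_mono[OF P, of k "Suc k"] by auto
      ultimately show ?case
        using Suc abs_length_diff_le_edit_dist[of "parts P u ! k" "slice (q k) (q (Suc k)) v"] by simp
    qed
    from this[OF that] have "\<bar>int (q i) - int (P ! i)\<bar> \<le>
      int (\<Sum>i<i. edit_dist (parts P u ! i) (slice (q i) (q (Suc i)) v))" by simp
    also have "\<dots> \<le> int (\<Sum>i<m. edit_dist (parts P u ! i) (slice (q i) (q (Suc i)) v))"
      using that by (intro zle_int[THEN iffD2] sum_mono2) auto
    finally show ?thesis using cost by linarith
  qed
  \<comment> \<open>Taking the largest candidate makes the rounding monotone, so the rounded cuts
    stay sorted. It is at least as close to \<open>q i\<close> as the one from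
    \<open>candidate_below\<close>.\<close>
  define s where "s i = Max {x \<in> set S. x \<le> q i}" for i
  have S0: "0 \<in> set S" "length v \<in> set S" using P0' by (auto simp: S candidates_def)
  have s_in: "s i \<in> set S" "s i \<le> q i" for i
    proof -
    have "0 \<in> {x \<in> set S. x \<le> q i}" using S0 by simp
    then have "s i \<in> {x \<in> set S. x \<le> q i}"
      unfolding s_def by (intro Max_in) auto
    then show "s i \<in> set S" "s i \<le> q i" by auto
  qed
  have s_ge: "x \<le> s i" if "x \<in> set S" "x \<le> q i" for x i
    using that unfolding s_def by (intro Max_ge) auto
  have s0: "s 0 = 0" using s_in[of 0] q by simp
  have sm: "s m = length v" using s_in[of m] s_ge[of "length v" m] S0 q by simp
  have s_mono: "s i \<le> s j" if "i \<le> j" "j \<le> m" for i j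
    using s_in[of i] mono[OF that] by (intro s_ge) auto
  have err: "real m * real (q i - s i) \<le> real ?ed" if i: "i \<le> m" for i
  proof -
    have "P ! i \<in> set P" using i len by simp
    then obtain x where x: "x \<in> set S" "x \<le> q i"
      "real m * (real (q i) - real x) \<le> \<bar>real (q i) - real (P ! i)\<bar>"
      using candidate_below[OF m _ P0' qL[OF i]] S by metis
    have "real m * real (q i - s i) \<le> real m * (real (q i) - real x)"
      using s_in[of i] s_ge[OF x(1,2)] by (intro mult_left_mono) auto
    then show ?thesis using x(3) dev[OF i] by linarith
  qed
  \<comment> \<open>Used with \<open>f = id\<close> for the left ends and with
    \<open>f = Suc\<close> for the right ends.\<close>
  have err_sum: "(\<Sum>i<m. q (f i) - s (f i)) \<le> ?ed" if "\<And>i. i < m \<Longrightarrow> f i \<le> m" for f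
  proof -
    have "real m * real (\<Sum>i<m. q (f i) - s (f i)) = (\<Sum>i<m. real m * real (q (f i) - s (f i)))"
      by (simp add: sum_distrib_left)
    also have "\<dots> \<le> (\<Sum>i<m. real ?ed)" using that err by (intro sum_mono) auto
    finally have "real m * real (\<Sum>i<m. q (f i) - s (f i)) \<le> real m * real ?ed" by simp
    then show ?thesis using m by (simp del: of_nat_sum)
  qed
  define Q where "Q = map s [0..<Suc m]"
  have Q: "Q ! i = s i" if "i \<le> m" for i
    using that unfolding Q_def by (subst nth_map) (auto simp del: upt_Suc)
  have lenQ: "length Q = Suc m" by (simp add: Q_def)
  have "sorted Q" unfolding sorted_iff_nth_mono using Q lenQ s_mono by auto
  moreover have "set Q \<subseteq> set S" using s_in by (auto simp: Q_def)
  ultimately have "chain S m (length v) Q"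
    unfolding chain_def using lenQ Q s0 sm by simp
  moreover have "(\<Sum>i<m. edit_dist (parts P u ! i) (slice (Q ! i) (Q ! Suc i) v)) \<le>
    (\<Sum>i<m. edit_dist (parts P u ! i) (slice (q i) (q (Suc i)) v) +
        ((q i - s i) + (q (Suc i) - s (Suc i))))"
  proof (intro sum_mono)
    fix i assume "i \<in> {..<m}"
    then have i: "i < m" by simp
    have "edit_dist (slice (q i) (q (Suc i)) v) (slice (s i) (s (Suc i)) v)
      \<le> (q i - s i) + (q (Suc i) - s (Suc i))"
      using i s_in s_mono mono qL by (intro edit_dist_slice) auto
    then show "edit_dist (parts P u ! i) (slice (Q ! i) (Q ! Suc i) v) \<le>
      edit_dist (parts P u ! i) (slice (q i) (q (Suc i)) v) + ((q i - s i) + (q (Suc i) - s (Suc i)))"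
      using i Q edit_dist_triangle[of "parts P u ! i" "slice (s i) (s (Suc i)) v" "slice (q i) (q (Suc i)) v"]
      by simp
  qed
  ultimately show ?thesis
    using cost err_sum[of id] err_sum[of Suc] by (intro exI[of _ Q]) (simp add: sum.distrib)
qed

section \<open>Step counts and feasibility of the computations\<close>

lemma bind_compE:
  assumes "(y, t) \<in> M \<triangleright> F"
  obtains x s r where "(x, s) \<in> M" "(y, r) \<in> F x" "t = s + r"
  using assms by (auto simp: bind_comp_def)

lemma tickE:
  assumes "(x, t) \<in> tick k M"
  obtains s where "(x, s) \<in> M" "t = k + s"
  using assms by (auto simp: tick_def)

lemma retE:
  assumes "(x, t) \<in> ret y"
  obtains "x = y" "t = 0"
  using assms by (auto simp: ret_def)

lemma ret_nonempty: "ret x \<noteq> {}"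
  by (simp add: ret_def)

lemma tick_nonempty: "M \<noteq> {} \<Longrightarrow> tick k M \<noteq> {}"
  by (auto simp: tick_def)

lemma bind_comp_nonempty:
  assumes "M \<noteq> {}" "\<And>x t. (x, t) \<in> M \<Longrightarrow> F x \<noteq> {}"
  shows "M \<triangleright> F \<noteq> {}"
proof -
  obtain x s where "(x, s) \<in> M" using assms(1) by auto
  moreover from this obtain y t where "(y, t) \<in> F x" using assms(2) by fastforce
  ultimately show ?thesis unfolding bind_comp_def by blast
qed

lemma mapM_comp_nonempty: "(\<And>x. x \<in> set xs \<Longrightarrow> F x \<noteq> {}) \<Longrightarrow> mapM_comp F xs \<noteq> {}"
proof (induction xs)
  case (Cons x xs)
  show ?case unfolding mapM_comp.simps
    by (intro tick_nonempty bind_comp_nonempty ret_nonempty Cons.IH Cons.prems)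
      (simp_all add: Cons.prems)
qed (simp add: ret_nonempty)

lemma mapM_compD:
  assumes "(ys, t) \<in> mapM_comp F xs"
  shows "\<exists>ts. length ys = length xs \<and> (\<forall>i<length xs. (ys ! i, ts i) \<in> F (xs ! i)) \<and>
    t = length xs + (\<Sum>i<length xs. ts i)"
  using assms
proof (induction xs arbitrary: ys t)
  case Nil
  then show ?case by (auto simp: ret_def)
next
  case (Cons x xs)
  obtain y s ys' r where y: "(y, s) \<in> F x" and ys': "(ys', r) \<in> mapM_comp F xs"
    and eq: "ys = y # ys'" "t = 1 + (s + r)"
    using Cons.prems by (auto elim!: bind_compE tickE retE)
  obtain ts where ts: "length ys' = length xs" "\<forall>i<length xs. (ys' ! i, ts i) \<in> F (xs ! i)"
    "r = length xs + (\<Sum>i<length xs. ts i)" using Cons.IH[OF ys'] by blast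
  show ?case
    using y ts eq
    by (intro exI[of _ "case_nat s ts"])
       (auto simp: nth_Cons sum.lessThan_Suc_shift simp del: sum.lessThan_Suc split: nat.splits)
qed

section \<open>Step counts of candidate generation and dynamic programming\<close>

lemma remdups_comp_time:
  "(ys, t) \<in> remdups_comp xs \<Longrightarrow> length ys \<le> length xs \<and> t \<le> (length xs)\<^sup>2"
proof (induction xs arbitrary: ys t)
  case Nil
  then show ?case by (auto simp: ret_def)
next
  case (Cons x xs)
  then obtain zs s where zs: "(zs, s) \<in> remdups_comp xs" "ys = List.insert x zs" "t = s + (length zs + 1)"
    by (auto elim!: bind_compE tickE retE)
  then have "length zs \<le> length xs" "s \<le> (length xs)\<^sup>2" using Cons.IH by auto
  then show ?case using zs(2,3) by (simp add: List.insert_def power2_eq_square)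
qed

lemma remdups_comp_nonempty: "remdups_comp xs \<noteq> {}"
proof (induction xs)
  case (Cons x xs)
  show ?case unfolding remdups_comp.simps
    by (intro tick_nonempty bind_comp_nonempty ret_nonempty Cons.IH)
qed (simp add: ret_nonempty)

lemma candidates_comp_nonempty: "candidates_comp m P K L \<noteq> {}"
  unfolding candidates_comp_def powers_comp_def Let_def
  by (intro bind_comp_nonempty tick_nonempty remdups_comp_nonempty) simp

text \<open>\<open>R\<close> is the length of the list before filtering: the cuts, \<open>L\<close>,
  and each cut shifted both ways by each power. Computing the powers, building the list and removing
  duplicates each take at most \<open>R\<^sup>2\<close> steps.\<close>

lemma candidates_comp_time:
  fixes m P K L
  defines "R \<equiv> length P + 1 + 2 * length P * (LEAST j. real (K + L + 1) < (1 + 1 / real m) ^ j)"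
  assumes "(S, t) \<in> candidates_comp m P K L" "0 < length P"
  shows "length S \<le> R" "t \<le> 3 * R\<^sup>2"
proof -
  define J where "J = (LEAST j. real (K + L + 1) < (1 + 1 / real m) ^ j)"
  define xs where "xs = map (\<lambda>j. (1 + 1 / real m) ^ j) [0..<J]"
  define F where "F ys = map int P @ [int L] @
    concat (map (\<lambda>p. map (\<lambda>x. \<lceil>real p + x\<rceil>) ys @ map (\<lambda>x. \<lceil>real p - x\<rceil>) ys) P)" for ys
  define raw where "raw = F xs"
  have comp: "candidates_comp m P K L = {(xs, J + 1)} \<triangleright> (\<lambda>ys. tick (length (F ys))
      (remdups_comp (map nat (filter (\<lambda>z. 0 \<le> z \<and> z \<le> int L) (F ys)))))"
    unfolding candidates_comp_def powers_comp_def Let_def xs_def J_def F_def ..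
  have raw: "length raw = R"
    unfolding R_def J_def[symmetric]
    by (simp add: raw_def F_def xs_def length_concat comp_def sum_list_triv)
  obtain s where s: "(S, s) \<in> remdups_comp (map nat (filter (\<lambda>z. 0 \<le> z \<and> z \<le> int L) raw))"
    and t: "t = J + 1 + (length raw + s)"
    using assms(2) unfolding comp raw_def by (auto elim!: bind_compE tickE)
  have le: "length (filter (\<lambda>z. 0 \<le> z \<and> z \<le> int L) raw) \<le> R"
    using raw length_filter_le by metis
  show "length S \<le> R" using remdups_comp_time[OF s] le by simp
  have "s \<le> R\<^sup>2" using remdups_comp_time[OF s] le
    by (simp) (meson le_trans power2_nat_le_eq_le)
  moreover have "J + 1 \<le> R"
  proof -
    have "1 * J \<le> 2 * length P * J" by (intro mult_right_mono) (use assms(3) in linarith)+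
    then show ?thesis unfolding R_def J_def[symmetric] by linarith
  qed
  moreover have "R \<le> R\<^sup>2" by (simp add: power2_eq_square)
  ultimately show "t \<le> 3 * R\<^sup>2" using t raw by linarith
qed

text \<open>A predecessor costs at most \<open>L + 2 + X\<close> for copying the substring and
  calling the black box, and one step each for filtering, for the traversal and for the search of
  the minimum.\<close>

lemma dp_entry_comp_time:
  assumes "(e, t) \<in> dp_entry_comp A tA p v row l" "l \<le> L"
    and X: "\<And>l'. l' \<le> l \<Longrightarrow> tA p (slice l' l v) \<le> X"
  shows "t \<le> length row * (L + 5 + X)"
proof -
  let ?f = "filter (\<lambda>e. fst e \<le> l) row"
  obtain es s where es: "(es, s) \<in> mapM_comp (\<lambda>(l', c, qs). tick (l - l' + 1)
             (blackbox_comp A tA p (slice l' l v) \<triangleright> (\<lambda>a. ret (l, c + a, l # qs)))) ?f"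
    and t: "t = length row + (s + length es)"
    using assms(1) unfolding dp_entry_comp_def
    by (auto elim!: bind_compE tickE simp: cheapest_comp_def)
  obtain ts where ts: "length es = length ?f" "s = length ?f + (\<Sum>i<length ?f. ts i)"
    "\<forall>i<length ?f. (es ! i, ts i) \<in> (\<lambda>(l', c, qs). tick (l - l' + 1)
             (blackbox_comp A tA p (slice l' l v) \<triangleright> (\<lambda>a. ret (l, c + a, l # qs)))) (?f ! i)"
    using mapM_compD[OF es] by blast
  have "ts i \<le> L + 2 + X" if i: "i < length ?f" for i
  proof -
    obtain l' c qs where x: "?f ! i = (l', c, qs)" by (cases "?f ! i") auto
    have "l' \<le> l" using nth_mem[OF i] x by auto
    then show ?thesis using ts(3) i x X[of l'] assms(2)
      by (fastforce elim!: bind_compE tickE retE simp: blackbox_comp_def)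
  qed
  then have "(\<Sum>i<length ?f. ts i) \<le> (\<Sum>i<length ?f. L + 2 + X)" by (intro sum_mono) auto
  then have "t \<le> length row + (length ?f * (L + 4 + X))"
    using t ts by (simp add: algebra_simps)
  also have "\<dots> \<le> length row + (length row * (L + 4 + X))"
    by (intro add_left_mono mult_right_mono) auto
  finally show ?thesis by (simp add: algebra_simps)
qed

text \<open>A computed row has one entry per element of \<open>S\<close>, and each entry looks at no
  more than \<open>R\<close> predecessors. The bound on \<open>row\<close> is a hypothesis of its
  own because the initial row is a singleton unrelated to \<open>S\<close>.\<close>

lemma dp_rows_comp_time:
  assumes "(row', t) \<in> dp_rows_comp A tA v S ps row" "length S \<le> R" "length row \<le> R"
    and "\<And>l. l \<in> set S \<Longrightarrow> l \<le> L"
    and "\<And>p l l'. p \<in> set ps \<Longrightarrow> tA p (slice l' l v) \<le> X"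
  shows "length row' \<le> R \<and> t \<le> length ps * (R + R\<^sup>2 * (L + 5 + X))"
  using assms(1,3,5)
proof (induction ps arbitrary: row t)
  case Nil
  then show ?case by (auto simp: ret_def)
next
  case (Cons p ps)
  obtain mid s1 s2 where mid: "(mid, s1) \<in> mapM_comp (dp_entry_comp A tA p v row) S"
    and rest: "(row', s2) \<in> dp_rows_comp A tA v S ps mid" and t: "t = s1 + s2"
    using Cons.prems(1) by (auto elim: bind_compE)
  obtain ts where ts: "length mid = length S" "s1 = length S + (\<Sum>i<length S. ts i)"
    "\<forall>i<length S. (mid ! i, ts i) \<in> dp_entry_comp A tA p v row (S ! i)"
    using mapM_compD[OF mid] by blast
  have "ts i \<le> R * (L + 5 + X)" if i: "i < length S" for i
  proof -
    have "ts i \<le> length row * (L + 5 + X)"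
      using ts(3) i assms(4) Cons.prems(3) by (intro dp_entry_comp_time[of "mid ! i"]) auto
    also have "\<dots> \<le> R * (L + 5 + X)" using Cons.prems(2) by (intro mult_right_mono) auto
    finally show ?thesis .
  qed
  then have "(\<Sum>i<length S. ts i) \<le> (\<Sum>i<length S. R * (L + 5 + X))" by (intro sum_mono) auto
  also have "\<dots> = length S * (R * (L + 5 + X))" by simp
  also have "\<dots> \<le> R * (R * (L + 5 + X))" using assms(2) by (intro mult_right_mono) auto
  finally have "s1 \<le> R + R\<^sup>2 * (L + 5 + X)"
    using ts(2) assms(2) by (simp add: power2_eq_square algebra_simps)
  moreover have "length row' \<le> R \<and> s2 \<le> length ps * (R + R\<^sup>2 * (L + 5 + X))"
    using Cons.prems(3) ts(1) assms(2) by (intro Cons.IH[OF rest]) auto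
  ultimately show ?case using t by simp
qed

lemma partition_comp_time:
  assumes "(Q, t) \<in> partition_comp A tA ps v S" "length S \<le> R" "1 \<le> R"
    and "\<And>l. l \<in> set S \<Longrightarrow> l \<le> L"
    and "\<And>p l l'. p \<in> set ps \<Longrightarrow> tA p (slice l' l v) \<le> X"
  shows "t \<le> length ps * (R + R\<^sup>2 * (L + 5 + X)) + (R + length ps + 1)"
proof -
  obtain row s where "(row, s) \<in> dp_rows_comp A tA v S ps [(0, 0, [0])]"
    "t = s + (length row + length ps + 1)"
    using assms(1) unfolding partition_comp_def by (auto elim!: bind_compE)
  with dp_rows_comp_time[of row s A tA v S ps "[(0, 0, [0])]" R L X] assms(2-) show ?thesis by simp
qed

section \<open>Existence of outcomes\<close>

lemma cheapest_comp_nonempty: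
  assumes "es \<noteq> []"
  shows "cheapest_comp es \<noteq> {}"
proof -
  have "Min ((\<lambda>e. fst (snd e)) ` set es) \<in> (\<lambda>e. fst (snd e)) ` set es"
    using assms by (intro Min_in) auto
  then obtain e where "e \<in> set es" "fst (snd e) = Min ((\<lambda>e. fst (snd e)) ` set es)" by auto
  then have "e \<in> set es \<and> (\<forall>e'\<in>set es. fst (snd e) \<le> fst (snd e'))" by simp
  then show ?thesis unfolding cheapest_comp_def by blast
qed

lemma dp_entry_comp_nonempty:
  assumes "e \<in> set row" "fst e \<le> l"
  shows "dp_entry_comp A tA p v row l \<noteq> {}"
proof -
  have ne: "filter (\<lambda>e. fst e \<le> l) row \<noteq> []" using assms by (auto simp: filter_empty_conv)
  show ?thesis unfolding dp_entry_comp_def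
  proof (intro tick_nonempty bind_comp_nonempty mapM_comp_nonempty cheapest_comp_nonempty)
    fix es t assume "(es, t) \<in> mapM_comp (\<lambda>(l', c, qs). tick (l - l' + 1)
        (blackbox_comp A tA p (slice l' l v) \<triangleright> (\<lambda>a. ret (l, c + a, l # qs))))
        (filter (\<lambda>e. fst e \<le> l) row)"
    from mapM_compD[OF this] ne show "es \<noteq> []" by fastforce
  next
    fix x
    show "(case x of (l', c, qs) \<Rightarrow> tick (l - l' + 1)
        (blackbox_comp A tA p (slice l' l v) \<triangleright> (\<lambda>a. ret (l, c + a, l # qs)))) \<noteq> {}"
      unfolding blackbox_comp_def
      by (cases x) (simp only: prod.case, intro tick_nonempty bind_comp_nonempty ret_nonempty, simp)
  qed
qed

lemma dp_rows_comp_nonempty: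
  assumes "row_ok A v S ps0 row" "0 \<in> set S"
  shows "dp_rows_comp A tA v S ps row \<noteq> {}"
  using assms(1)
proof (induction ps arbitrary: ps0 row)
  case Nil
  then show ?case by (simp add: ret_def)
next
  case (Cons p ps)
  \<comment> \<open>The chain that stays at 0 is always available, so each row has an entry at
    position 0. It serves as predecessor for every \<open>l\<close>.\<close>
  have "chain S (length ps0) 0 (replicate (Suc (length ps0)) 0)"
    using assms(2) by (auto simp: chain_def simp del: replicate_Suc)
  then obtain c qs where row: "(0, c, qs) \<in> set row"
    using Cons.prems unfolding row_ok_def by blast
  show ?case unfolding dp_rows_comp.simps
  proof (intro bind_comp_nonempty mapM_comp_nonempty dp_entry_comp_nonempty[OF row])
    fix mid s assume "(mid, s) \<in> mapM_comp (dp_entry_comp A tA p v row) S"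
    then have "(mid, s + 0) \<in> dp_rows_comp A tA v S [p] row"
      unfolding dp_rows_comp.simps bind_comp_def ret_def by blast
    from dp_rows_comp_ok[OF Cons.prems this] show "dp_rows_comp A tA v S ps mid \<noteq> {}"
      by (rule Cons.IH)
  qed simp
qed

lemma partition_comp_nonempty:
  assumes "0 \<in> set S" "length v \<in> set S" "ps \<noteq> []"
  shows "partition_comp A tA ps v S \<noteq> {}"
  unfolding partition_comp_def
proof (rule bind_comp_nonempty)
  have ok: "row_ok A v S [] [(0, 0, [0])]"
    using assms(1) by (auto simp: row_ok_def chain_def chain_cost_def)
  then show "dp_rows_comp A tA v S ps [(0, 0, [0])] \<noteq> {}"
    using assms(1) by (rule dp_rows_comp_nonempty)
  fix row s assume "(row, s) \<in> dp_rows_comp A tA v S ps [(0, 0, [0])]"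
  from dp_rows_comp_ok[OF ok this] have "row_ok A v S ps row" by simp
  \<comment> \<open>All of \<open>v\<close> is given to the last part.\<close>
  moreover have "chain S (length ps) (length v) (replicate (length ps) 0 @ [length v])"
    using assms by (auto simp: chain_def nth_append sorted_append)
  ultimately obtain c qs where "(length v, c, qs) \<in> set row" unfolding row_ok_def by blast
  then show "{(rev qs, length row + length ps + 1) | qs c. (length v, c, qs) \<in> set row} \<noteq> {}"
    by blast
qed

lemma candidates_comp_set:
  assumes "(S, t) \<in> candidates_comp m P (length u) L" "2 \<le> m" "is_partition m u P"
  shows "set S = candidates m P L" "0 \<in> set S" "L \<in> set S"
proof -
  have P: "length P = m + 1" "P ! 0 = 0" using assms(3) by (auto simp: is_partition_def)
  have "\<forall>p\<in>set P. p \<le> length u"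
    using partition_le_length[OF assms(3)] P(1) by (auto simp: in_set_conv_nth)
  then show S: "set S = candidates m P L" using set_candidates_comp[OF assms(1,2)] by simp
  have "0 \<in> set P" using P by (metis nth_mem zero_less_Suc Suc_eq_plus1)
  then show "0 \<in> set S" "L \<in> set S" by (auto simp: S candidates_def)
qed

text \<open>The guarantees quantify over all outcomes; this keeps them from being vacuous.\<close>

lemma algorithm_B_nonempty:
  assumes "2 \<le> m"
  shows "algorithm_B m A tA u v \<noteq> {}"
proof (induction "length u" arbitrary: u v rule: less_induct)
  case less
  show ?case
  proof (cases "length u \<le> 1")
    case True
    then show ?thesis using ex_optimal_alignment[of u v]
      by (simp add: algorithm_B.simps[of m A tA u v] base_comp_def)
  next
    case False
    have *: "partition_comp A tA (parts P u) v S \<noteq> {}"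
      if "(P, t1) \<in> equipartition_comp m u" "(S, t2) \<in> candidates_comp m P (length u) (length v)"
      for P S t1 t2
    proof -
      have P: "is_partition m u P" using that(1) by (auto simp: equipartition_comp_def is_equipartition_def)
      have "length (parts P u) = m" using P by (simp add: is_partition_def)
      then have "parts P u \<noteq> []" using assms by (metis list.size(3) not_numeral_le_zero)
      then show ?thesis
        using candidates_comp_set[OF that(2) assms P] by (intro partition_comp_nonempty)
    qed
    have "equipartition_comp m u \<noteq> {}"
      using ex_equipartition[of m u] assms by (auto simp: equipartition_comp_def)
    then show ?thesis
      unfolding algorithm_B.simps[of m A tA u v] if_not_P[OF False]
      using less equipartition_parts_shorter[OF _ False] *
      by (intro bind_comp_nonempty tick_nonempty candidates_comp_nonempty mapM_comp_nonempty ret_nonempty)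
         (auto dest: set_zip_leftD)
  qed
qed

text \<open>One unfolding of the recursive case, shared by the proofs of correctness and of running
  time. The summands of \<open>t\<close> belong, in order, to the equipartition, the candidates,
  cutting \<open>u\<close> with the dynamic program, cutting \<open>v\<close> with the recursive
  calls, and the joining.\<close>

lemma algorithm_B_step:
  assumes "(es, t) \<in> algorithm_B m A tA u v" "\<not> length u \<le> 1"
  obtains P S tS Q tQ ess ts where
    "2 \<le> m" "is_equipartition m u P" "(S, tS) \<in> candidates_comp m P (length u) (length v)"
    "(Q, tQ) \<in> partition_comp A tA (parts P u) v S" "is_partition m v Q"
    "length ess = m"
    "\<forall>i<m. (ess ! i, ts i) \<in> algorithm_B m A tA (parts P u ! i) (parts Q v ! i)"
    "es = join_alignments Q ess"
    "t = m + 1 + tS + (length u + m + tQ) + (length v + m + (m + (\<Sum>i<m. ts i))) +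
      (length (concat ess) + m)"
proof -
  obtain P S tS Q tQ ess tR where
    P: "2 \<le> m" "is_equipartition m u P" and
    S: "(S, tS) \<in> candidates_comp m P (length u) (length v)" and
    Q: "(Q, tQ) \<in> partition_comp A tA (parts P u) v S" and
    ess: "(ess, tR) \<in> mapM_comp (\<lambda>(p, q). algorithm_B m A tA p q) (zip (parts P u) (parts Q v))"
      "es = join_alignments Q ess" and
    t: "t = m + 1 + tS + (length u + m + tQ) + (length v + m + tR) + (length (concat ess) + m)"
    using assms(1) unfolding algorithm_B.simps[of m A tA u v] if_not_P[OF assms(2)]
    by (elim bind_compE tickE retE) (auto simp: equipartition_comp_def)
  have part: "is_partition m u P" using P(2) by (simp add: is_equipartition_def)
  have lenP: "length (parts P u) = m" using part by (simp add: is_partition_def)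
  have "chain S m (length v) Q"
    using partition_comp_minimizer(1)[OF Q] candidates_comp_set[OF S P(1) part] lenP by simp
  then have Qp: "is_partition m v Q" by (auto simp: chain_def is_partition_def)
  then have lenQ: "length (parts Q v) = m" by (simp add: is_partition_def)
  obtain ts where ts: "length ess = m" "tR = m + (\<Sum>i<m. ts i)"
    "\<forall>i<m. (ess ! i, ts i) \<in> algorithm_B m A tA (parts P u ! i) (parts Q v ! i)"
    using mapM_compD[OF ess(1)] lenP lenQ by auto
  show thesis using that[OF P S Q Qp ts(1) _ ess(2), of ts] ts t by simp
qed

section \<open>Approximation guarantee\<close>

text \<open>A one-character string has distance 1 from the empty string, so the two bounds on the
  black box enclose 1. This makes powers of \<open>3 * \<gamma> n\<close> grow with the
  exponent.\<close>

lemma approximates_ge_1: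
  fixes A :: "'a list \<Rightarrow> 'a list \<Rightarrow> real"
  assumes "approximates A \<gamma>" "0 < n"
  shows "1 \<le> \<gamma> n"
proof -
  define u :: "'a list" where "u = [undefined]"
  have "edit_dist u [] = 1"
    using edit_dist_le_length[of u "[]"] abs_length_diff_le_edit_dist[of u "[]"] by (simp add: u_def)
  moreover have "length u + length ([] :: 'a list) \<le> n" using assms(2) by (simp add: u_def)
  then have "real (edit_dist u []) \<le> A u []" "A u [] \<le> \<gamma> n * real (edit_dist u [])"
    using assms unfolding approximates_def by blast+
  ultimately show ?thesis by simp
qed

text \<open>The lower bound on the black box is used at the chosen \<open>Q\<close> and the upper
  bound at the rounded partition \<open>R\<close>; minimality of \<open>Q\<close> connects them. All
  pairs involved have total length at most \<open>n\<close>, so a single factor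
  \<open>\<gamma> n\<close> suffices.\<close>

lemma partition_comp_approx:
  assumes A: "approximates A \<gamma>" and n: "0 < n" "length u + length v \<le> n" and m: "2 \<le> m"
    and P: "is_partition m u P" and S: "(S, tS) \<in> candidates_comp m P (length u) (length v)"
    and Q: "(Q, tQ) \<in> partition_comp A tA (parts P u) v S"
  shows "real (\<Sum>i<m. edit_dist (parts P u ! i) (parts Q v ! i)) \<le> 3 * \<gamma> n * real (edit_dist u v)"
proof -
  note S' = candidates_comp_set[OF S m P]
  have lenP: "length (parts P u) = m" using P by (simp add: is_partition_def)
  have Qc: "chain S m (length v) Q" using partition_comp_minimizer(1)[OF Q S'(2)] lenP by simp
  obtain R where R: "chain S m (length v) R"
    and Rcost: "(\<Sum>i<m. edit_dist (parts P u ! i) (slice (R ! i) (R ! Suc i) v)) \<le> 3 * edit_dist u v"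
    using ex_rounded_partition[OF P _ S'(1)] m by auto
  have len: "length (parts P u ! i) + length (slice a b v) \<le> n" if "i < m" for i a b
  proof -
    have "length (parts P u ! i) \<le> length u"
      using that sum_length_parts[OF P] member_le_sum[of i "{..<m}" "\<lambda>i. length (parts P u ! i)"] by simp
    then show ?thesis using n(2) by (simp add: slice_def)
  qed
  have "real (\<Sum>i<m. edit_dist (parts P u ! i) (parts Q v ! i))
      = (\<Sum>i<m. real (edit_dist (parts P u ! i) (slice (Q ! i) (Q ! Suc i) v)))"
    using Qc by (simp add: nth_parts chain_def)
  also have "\<dots> \<le> chain_cost A (parts P u) v Q"
    unfolding chain_cost_def lenP using A n(1) len
    by (intro sum_mono) (auto simp: approximates_def)
  also have "\<dots> \<le> chain_cost A (parts P u) v R"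
    using partition_comp_minimizer(2)[OF Q S'(2)] R lenP by simp
  also have "\<dots> \<le> (\<Sum>i<m. \<gamma> n * real (edit_dist (parts P u ! i) (slice (R ! i) (R ! Suc i) v)))"
    unfolding chain_cost_def lenP using A n(1) len
    by (intro sum_mono) (auto simp: approximates_def)
  also have "\<dots> = \<gamma> n * real (\<Sum>i<m. edit_dist (parts P u ! i) (slice (R ! i) (R ! Suc i) v))"
    by (simp add: sum_distrib_left)
  also have "\<dots> \<le> \<gamma> n * real (3 * edit_dist u v)"
    using Rcost approximates_ge_1[OF A n(1)] by (intro mult_left_mono of_nat_mono) auto
  finally show ?thesis by (simp add: ac_simps)
qed

text \<open>The induction is on the number \<open>h\<close> of levels still allowed. A branch may
  stop early, since the factor per level is at least 1. The bound by
  \<open>length u + length v\<close> is carried along because the time analysis needs it for the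
  joining step.\<close>

lemma algorithm_B_correct:
  assumes A: "approximates A \<gamma>" and n: "0 < n"
    and "(es, t) \<in> algorithm_B m A tA u v" "length u \<le> m ^ h" "length u + length v \<le> n"
  shows "alignment es u v \<and> length es \<le> length u + length v \<and>
    real (length es) \<le> (3 * \<gamma> n) ^ h * real (edit_dist u v)"
  using assms(3-)
proof (induction h arbitrary: u v es t)
  case base: 0
  then have "(es, t) \<in> base_comp u v"
    by (subst (asm) algorithm_B.simps) simp
  then show ?case using edit_dist_le_length[of u v] by (auto simp: base_comp_def)
next
  case (Suc h)
  have \<gamma>: "1 \<le> 3 * \<gamma> n" using approximates_ge_1[OF A n] by simp
  show ?case
  proof (cases "length u \<le> 1")
    case True
    then have "(es, t) \<in> base_comp u v"
      using Suc.prems(1) by (subst (asm) algorithm_B.simps) simp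
    then have *: "alignment es u v" "length es = edit_dist u v" by (auto simp: base_comp_def)
    have "1 * real (edit_dist u v) \<le> (3 * \<gamma> n) ^ Suc h * real (edit_dist u v)"
      using \<gamma> by (intro mult_right_mono one_le_power) auto
    then show ?thesis using * edit_dist_le_length[of u v] by simp
  next
    case False
    obtain P S tS Q tQ ess ts where st: "2 \<le> m" "is_equipartition m u P"
      "(S, tS) \<in> candidates_comp m P (length u) (length v)"
      "(Q, tQ) \<in> partition_comp A tA (parts P u) v S" "is_partition m v Q"
      "length ess = m"
      "\<forall>i<m. (ess ! i, ts i) \<in> algorithm_B m A tA (parts P u ! i) (parts Q v ! i)"
      "es = join_alignments Q ess"
      "t = m + 1 + tS + (length u + m + tQ) + (length v + m + (m + (\<Sum>i<m. ts i))) +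
        (length (concat ess) + m)"
      by (rule algorithm_B_step[OF Suc.prems(1) False], rule that)
    have P: "is_partition m u P" using st(2) by (simp add: is_equipartition_def)
    have IH: "alignment (ess ! i) (parts P u ! i) (parts Q v ! i) \<and>
      length (ess ! i) \<le> length (parts P u ! i) + length (parts Q v ! i) \<and>
      real (length (ess ! i)) \<le> (3 * \<gamma> n) ^ h * real (edit_dist (parts P u ! i) (parts Q v ! i))"
      if i: "i < m" for i
    proof (rule Suc.IH[OF st(7)[rule_format, OF i] length_equipartition_part[OF st(2) Suc.prems(2) i]])
      show "length (parts P u ! i) + length (parts Q v ! i) \<le> n"
        using i sum_length_parts[OF P] sum_length_parts[OF st(5)] Suc.prems(3)
          member_le_sum[of i "{..<m}" "\<lambda>i. length (parts P u ! i)"]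
          member_le_sum[of i "{..<m}" "\<lambda>i. length (parts Q v ! i)"] by simp
    qed
    have "length es = sum_list (map length ess)"
      unfolding st(8) using st(5,6) by (intro length_join_alignments) (simp add: is_partition_def)
    then have len: "length es = (\<Sum>i<m. length (ess ! i))"
      using st(6) by (simp add: sum_list_sum_nth lessThan_atLeast0)
    have "alignment es u v"
      unfolding st(8) using IH by (intro alignment_join[OF P st(5,6)]) blast
    moreover have "length es \<le> (\<Sum>i<m. length (parts P u ! i) + length (parts Q v ! i))"
      unfolding len using IH by (intro sum_mono) blast
    then have "length es \<le> length u + length v"
      using sum_length_parts[OF P] sum_length_parts[OF st(5)] by (simp add: sum.distrib)
    moreover have "real (length es) \<le> (\<Sum>i<m. (3 * \<gamma> n) ^ h * real (edit_dist (parts P u ! i) (parts Q v ! i)))"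
      unfolding len of_nat_sum using IH by (intro sum_mono) blast
    then have "real (length es) \<le> (3 * \<gamma> n) ^ h * real (\<Sum>i<m. edit_dist (parts P u ! i) (parts Q v ! i))"
      by (simp add: sum_distrib_left)
    then have "real (length es) \<le> (3 * \<gamma> n) ^ h * (3 * \<gamma> n * real (edit_dist u v))"
      using partition_comp_approx[OF A n Suc.prems(3) st(1) P st(3,4)] \<gamma>
      by (smt (verit) mult_left_mono zero_le_power)
    ultimately show ?thesis by (simp add: ac_simps)
  qed
qed

section \<open>Running time\<close>

lemma superadditive_sum:
  fixes T :: "nat \<Rightarrow> real" and k :: nat
  assumes "\<And>j k. T j + T k \<le> T (j + k)" "0 \<le> T 0"
  shows "(\<Sum>i<k. T (f i)) \<le> T (\<Sum>i<k. f i)"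
proof (induction k)
  case (Suc k)
  then show ?case using assms(1)[of "\<Sum>i<k. f i" "f k"] by simp
qed (simp add: assms)

text \<open>A call on a single character lasts at least one step, so \<open>1 \<le> T 1\<close>, and
  superadditivity does the rest. Linear overheads can thus be charged to \<open>T\<close>.\<close>

lemma runs_in_timeD:
  fixes tA :: "'a list \<Rightarrow> 'a list \<Rightarrow> nat"
  assumes "runs_in_time tA T"
  shows "real k \<le> T k" "0 \<le> T k"
proof -
  have add: "T j + T k \<le> T (j + k)" for j k using assms by (simp add: runs_in_time_def)
  have le: "real (tA u v) \<le> T (length u + length v)" for u v
    using assms by (simp add: runs_in_time_def)
  have T1: "1 \<le> T 1"
  proof -
    define u :: "'a list" where "u = [undefined]"
    have "1 \<le> tA u []" using assms by (simp add: runs_in_time_def u_def)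
    then show ?thesis using le[of u "[]"] by (simp add: u_def)
  qed
  show "real k \<le> T k"
  proof (induction k)
    case 0
    then show ?case using le[of "[]" "[]"] by simp
  next
    case (Suc k)
    then show ?case using add[of k 1] T1 by simp
  qed
  then show "0 \<le> T k" by (rule order_trans[rotated]) simp
qed

lemma number_of_powers_le:
  assumes "0 < m" "0 < n"
  shows "real (LEAST j. real N < (1 + 1 / real m) ^ j) \<le> 1 + (real m + 1) * ln (real (max 1 N))"
proof -
  let ?b = "1 + 1 / real m"
  have b: "1 < ?b" using assms by simp
  then obtain j0 where j0: "real N < ?b ^ j0" using real_arch_pow by blast
  show ?thesis
  proof (cases "LEAST j. real N < ?b ^ j")
    case (Suc j)
    have "\<not> real N < ?b ^ j"
      using not_less_Least[of j "\<lambda>j. real N < ?b ^ j"] Suc by simp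
    then have "?b ^ j \<le> real (max 1 N)" by simp
    moreover have "0 < ?b ^ j" by (rule zero_less_power) (use b in linarith)
    ultimately have "ln (?b ^ j) \<le> ln (real (max 1 N))" by (intro ln_mono) auto
    then have j: "real j * ln ?b \<le> ln (real (max 1 N))" using b by (simp add: ln_realpow)
    \<comment> \<open>The inequality \<open>ln x \<le> x - 1\<close> at \<open>x = 1 / b\<close>
      turns into \<open>1 / (m + 1) \<le> ln b\<close>.\<close>
    have "ln (inverse ?b) \<le> inverse ?b - 1"
      by (intro ln_le_minus_one) (use b in \<open>simp add: add_pos_nonneg\<close>)
    moreover have "inverse ?b - 1 = - 1 / (real m + 1)" using assms by (simp add: field_simps)
    ultimately have "1 / (real m + 1) \<le> ln ?b" using b by (simp add: ln_inverse)
    then have "real j * (1 / (real m + 1)) \<le> real j * ln ?b" by (intro mult_left_mono) auto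
    then have "real j * (1 / (real m + 1)) \<le> ln (real (max 1 N))" using j by linarith
    then have "real j \<le> (real m + 1) * ln (real (max 1 N))" by (simp add: field_simps)
    then show ?thesis using Suc by simp
  qed simp
qed

text \<open>With \<open>l = 1 + ln n\<close>, the number \<open>J\<close> of powers is at most
  \<open>2 * m * l\<close>. The constant 7 is 6 from \<open>2 * (m + 1) * J\<close>, using
  \<open>2 * (m + 1) \<le> 3 * m\<close>, plus 1 from
  \<open>m + 2 \<le> m\<^sup>2 * l\<close>.\<close>

lemma candidates_bound:
  assumes m: "2 \<le> m" and n: "0 < n" "N \<le> n + 1"
  shows "real (m + 1 + 1 + 2 * (m + 1) * (LEAST j. real N < (1 + 1 / real m) ^ j))
    \<le> 7 * (real m)\<^sup>2 * (1 + ln (real n))"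
proof -
  define l where "l = 1 + ln (real n)"
  define J where "J = (LEAST j. real N < (1 + 1 / real m) ^ j)"
  have l: "1 \<le> l" using n by (simp add: l_def)
  have ml: "2 * 1 \<le> real m * l" using m l by (intro mult_mono) auto
  have ml2: "2 * l \<le> real m * l" using m l by (intro mult_right_mono) auto
  have "ln (real (max 1 N)) \<le> ln (2 * real n)" using n by (intro ln_mono) auto
  also have "\<dots> \<le> l" using n ln_le_minus_one[of 2] by (simp add: ln_mult l_def)
  finally have "(real m + 1) * ln (real (max 1 N)) \<le> (real m + 1) * l" by (intro mult_left_mono) auto
  then have "real J \<le> 1 + (real m + 1) * l"
    using number_of_powers_le[of m n N] m n unfolding J_def by linarith
  also have "\<dots> \<le> 2 * (real m * l)"
    using ml2 l unfolding distrib_right mult_1 by linarith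
  finally have "(2 * (real m + 1)) * real J \<le> (3 * real m) * (2 * (real m * l))"
    using m l by (intro mult_mono[of _ "3 * real m" _ "2 * (real m * l)"]) auto
  moreover have "real m + 2 \<le> real m * (real m * l)"
  proof -
    have "real m * (2 * 1) \<le> real m * (real m * l)" using ml by (intro mult_left_mono) auto
    then show ?thesis using m by linarith
  qed
  ultimately show ?thesis
    unfolding l_def[symmetric] J_def[symmetric] by (simp add: power2_eq_square algebra_simps)
qed

text \<open>Every term is compared with \<open>W = m * R\<^sup>2 * X\<close>. The dynamic program
  \<open>q\<close> takes 11 units, \<open>s\<close> takes 3, the six loose \<open>m\<close> take 6,
  and \<open>1\<close>, \<open>a + L\<close> and \<open>c\<close> take one each.\<close>

lemma step_cost_bound:
  fixes m R L X a b s q c :: nat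
  assumes "1 \<le> m" "1 \<le> R" "1 \<le> X" "a + L \<le> X" "c \<le> X"
    and "s \<le> 3 * R\<^sup>2" "q \<le> m * (R + R\<^sup>2 * (L + 5 + X)) + (R + m + 1)"
  shows "m + 1 + s + (a + m + q) + (L + m + (m + m)) + (c + m) \<le> 23 * (m * R\<^sup>2 * X)"
proof -
  define W where "W = m * R\<^sup>2 * X"
  have R2: "1 \<le> R\<^sup>2" using assms by simp
  have RR: "R \<le> R\<^sup>2" by (simp add: power2_eq_square)
  have mono: "x * y * z \<le> W" if "x \<le> m" "y \<le> R\<^sup>2" "z \<le> X" for x y z
    unfolding W_def using that by (intro mult_mono) auto
  have "m \<le> W" "1 \<le> W" "R\<^sup>2 \<le> W" "R \<le> W" "X \<le> W" "m * R \<le> W" "m * R\<^sup>2 * L \<le> W" "m * R\<^sup>2 \<le> W"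
    using mono[of m 1 1] mono[of 1 1 1] mono[of 1 "R\<^sup>2" 1] mono[of 1 R 1] mono[of 1 1 X]
      mono[of m R 1] mono[of m "R\<^sup>2" L] mono[of m "R\<^sup>2" 1] assms R2 RR by simp_all
  moreover have "q \<le> m * R + m * R\<^sup>2 * L + 5 * (m * R\<^sup>2) + W + (R + m + 1)"
    using assms(7) by (simp add: W_def algebra_simps)
  ultimately show ?thesis using assms(4-6) unfolding W_def[symmetric] by linarith
qed

text \<open>\<open>K * T N\<close> with \<open>N = length u + length v\<close> bounds the own cost
  of a node, where \<open>23 * 49\<close> joins \<open>step_cost_bound\<close> with the square of
  the 7 in \<open>candidates_bound\<close>. By superadditivity each level costs no more than that in
  total. The extra 1 is there for a pair of empty strings, which takes a step although
  \<open>T 0 = 0\<close>.\<close>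

lemma algorithm_B_time:
  fixes n m :: nat
  assumes A: "approximates A \<gamma>" and T: "runs_in_time tA T" and n: "0 < n"
  defines "K \<equiv> 23 * 49 * (real m ^ 5 * (1 + ln (real n))\<^sup>2)"
  assumes "2 \<le> m" "(es, t) \<in> algorithm_B m A tA u v" "length u \<le> m ^ h" "length u + length v \<le> n"
  shows "real t \<le> 1 + (real h + 1) * (K * T (length u + length v))"
  using assms(6-)
proof (induction h arbitrary: u v es t)
  case base: 0
  note Tn = runs_in_timeD[OF T]
  have "1 * 1 \<le> real m ^ 5 * (1 + ln (real n))\<^sup>2"
    using assms(5) n by (intro mult_mono one_le_power) auto
  then have K: "1 \<le> K" by (simp add: K_def)
  have "(es, t) \<in> base_comp u v" using base by (subst (asm) algorithm_B.simps) simp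
  then have "real t \<le> 1 + T (length u + length v)"
    using Tn(1)[of "length u + length v"] by (auto simp: base_comp_def)
  also have "\<dots> \<le> 1 + K * T (length u + length v)"
    using mult_right_mono[OF K Tn(2)] by simp
  finally show ?case by simp
next
  case (Suc h)
  note Tn = runs_in_timeD[OF T]
  let ?N = "length u + length v"
  have "1 * 1 \<le> real m ^ 5 * (1 + ln (real n))\<^sup>2"
    using assms(5) n by (intro mult_mono one_le_power) auto
  then have K: "1 \<le> K" by (simp add: K_def)
  show ?case
  proof (cases "length u \<le> 1")
    case True
    then have "(es, t) \<in> base_comp u v"
      using Suc.prems(1) by (subst (asm) algorithm_B.simps) simp
    then have "real t \<le> 1 + T ?N"
      using Tn(1)[of ?N] by (auto simp: base_comp_def)
    also have "\<dots> \<le> 1 + (real (Suc h) + 1) * (K * T ?N)"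
      using mult_mono[of 1 "real (Suc h) + 1" "T ?N" "K * T ?N"] mult_right_mono[OF K Tn(2)] Tn(2)
      by simp
    finally show ?thesis .
  next
    case False
    obtain P S tS Q tQ ess ts where st: "2 \<le> m" "is_equipartition m u P"
      "(S, tS) \<in> candidates_comp m P (length u) (length v)"
      "(Q, tQ) \<in> partition_comp A tA (parts P u) v S" "is_partition m v Q"
      "length ess = m"
      "\<forall>i<m. (ess ! i, ts i) \<in> algorithm_B m A tA (parts P u ! i) (parts Q v ! i)"
      "es = join_alignments Q ess"
      "t = m + 1 + tS + (length u + m + tQ) + (length v + m + (m + (\<Sum>i<m. ts i))) +
        (length (concat ess) + m)"
      by (rule algorithm_B_step[OF Suc.prems(1) False], rule that)
    have P: "is_partition m u P" using st(2) by (simp add: is_equipartition_def)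
    have lenP: "length P = m + 1" using P by (simp add: is_partition_def)
    define R where "R = m + 1 + 1 + 2 * (m + 1) *
      (LEAST j. real (length u + length v + 1) < (1 + 1 / real m) ^ j)"
    \<comment> \<open>Step counts are natural numbers, so rounding \<open>T\<close> down still
      bounds them.\<close>
    define X where "X = nat \<lfloor>T ?N\<rfloor>"
    have XT: "real X \<le> T ?N" using Tn(2)[of ?N] by (simp add: X_def)
    have NX: "?N \<le> X" using Tn(1)[of ?N] by (simp add: X_def le_nat_iff le_floor_iff)
    have S: "length S \<le> R" "tS \<le> 3 * R\<^sup>2"
      using candidates_comp_time[OF st(3)] lenP by (simp_all add: R_def)
    have Sle: "l \<le> length v" if "l \<in> set S" for l
      using that candidates_comp_set(1)[OF st(3,1) P] by (simp add: candidates_def)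
    have tA: "tA p (slice l' l v) \<le> X" if "p \<in> set (parts P u)" for p l' l
    proof -
      have "length p \<le> length u"
        using that sum_length_parts[OF P] lenP
          member_le_sum[of _ "{..<m}" "\<lambda>i. length (parts P u ! i)"]
        by (auto simp: in_set_conv_nth)
      then have "length p + length (slice l' l v) \<le> ?N" by (simp add: slice_def)
      then have "real (tA p (slice l' l v)) \<le> T ?N" using T by (simp add: runs_in_time_def)
      then show ?thesis by (simp add: X_def le_nat_iff le_floor_iff)
    qed
    have tQ: "tQ \<le> m * (R + R\<^sup>2 * (length v + 5 + X)) + (R + m + 1)"
      using partition_comp_time[OF st(4) S(1) _ Sle tA] lenP by (simp add: R_def)
    have "length es = length (concat ess)"
      unfolding st(8) length_concat using st(5,6)
      by (intro length_join_alignments) (simp add: is_partition_def)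
    then have "length (concat ess) \<le> X"
      using algorithm_B_correct[OF A n Suc.prems] NX by simp
    then have own: "m + 1 + tS + (length u + m + tQ) + (length v + m + (m + m)) +
        (length (concat ess) + m) \<le> 23 * (m * R\<^sup>2 * X)"
      using st(1) NX S(2) tQ False by (intro step_cost_bound) (auto simp: R_def)
    have "real R \<le> 7 * (real m)\<^sup>2 * (1 + ln (real n))"
      unfolding R_def using Suc.prems(3) n st(1) by (intro candidates_bound) auto
    then have "(real R)\<^sup>2 \<le> (7 * (real m)\<^sup>2 * (1 + ln (real n)))\<^sup>2"
      by (intro power_mono) auto
    then have "23 * (real m * (real R)\<^sup>2 * real X) \<le>
        23 * (real m * (7 * (real m)\<^sup>2 * (1 + ln (real n)))\<^sup>2 * T ?N)"
      using XT by (intro mult_left_mono mult_mono) auto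
    also have "\<dots> = K * T ?N"
      by (simp add: K_def power_mult_distrib power2_eq_square numeral_eq_Suc)
    finally have own': "23 * (real m * (real R)\<^sup>2 * real X) \<le> K * T ?N" .
    have IH: "real (ts i) \<le> 1 + (real h + 1) * (K * T (length (parts P u ! i) + length (parts Q v ! i)))"
      if i: "i < m" for i
    proof (rule Suc.IH[OF st(7)[rule_format, OF i] length_equipartition_part[OF st(2) Suc.prems(2) i]])
      show "length (parts P u ! i) + length (parts Q v ! i) \<le> n"
        using i sum_length_parts[OF P] sum_length_parts[OF st(5)] Suc.prems(3)
          member_le_sum[of i "{..<m}" "\<lambda>i. length (parts P u ! i)"]
          member_le_sum[of i "{..<m}" "\<lambda>i. length (parts Q v ! i)"] by simp
    qed
    have "real (\<Sum>i<m. ts i) \<le>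
        (\<Sum>i<m. 1 + (real h + 1) * (K * T (length (parts P u ! i) + length (parts Q v ! i))))"
      unfolding of_nat_sum using IH by (intro sum_mono) simp
    also have "\<dots> = real m + (real h + 1) *
        (K * (\<Sum>i<m. T (length (parts P u ! i) + length (parts Q v ! i))))"
      by (simp add: sum.distrib sum_distrib_left)
    also have "\<dots> \<le> real m + (real h + 1) *
        (K * T (\<Sum>i<m. length (parts P u ! i) + length (parts Q v ! i)))"
      using K T Tn(2)[of 0]
      by (intro add_left_mono mult_left_mono superadditive_sum) (auto simp: runs_in_time_def)
    also have "(\<Sum>i<m. length (parts P u ! i) + length (parts Q v ! i)) = ?N"
      using sum_length_parts[OF P] sum_length_parts[OF st(5)] by (simp add: sum.distrib)
    finally have rec: "real (\<Sum>i<m. ts i) \<le> real m + (real h + 1) * (K * T ?N)" .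
    \<comment> \<open>The additional \<open>m\<close> on both sides pays for the extra 1 of each of
      the \<open>m\<close> recursive calls.\<close>
    have "t + m = (m + 1 + tS + (length u + m + tQ) + (length v + m + (m + m)) +
        (length (concat ess) + m)) + (\<Sum>i<m. ts i)" by (simp add: st(9))
    then have "t + m \<le> 23 * (m * R\<^sup>2 * X) + (\<Sum>i<m. ts i)" using own by linarith
    then have "real (t + m) \<le> real (23 * (m * R\<^sup>2 * X) + (\<Sum>i<m. ts i))" by (rule of_nat_mono)
    then have "real t + real m \<le> K * T ?N + real (\<Sum>i<m. ts i)" using own' by (simp del: of_nat_sum)
    then have "real t \<le> K * T ?N + (real h + 1) * (K * T ?N)" using rec by linarith
    then show ?thesis by (simp add: algebra_simps)
  qed
qed

theorem theorem5:
  shows "\<exists>(C::real) > 0. \<exists>(D::real) > 0. \<exists>k::nat.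
    \<forall>(A :: 'a list \<Rightarrow> 'a list \<Rightarrow> real) (tA :: 'a list \<Rightarrow> 'a list \<Rightarrow> nat)
     (\<gamma> :: nat \<Rightarrow> real) (T :: nat \<Rightarrow> real) (m :: nat) (n :: nat) (u :: 'a list) (v :: 'a list).
      approximates A \<gamma> \<longrightarrow> runs_in_time tA T \<longrightarrow> 2 \<le> m \<longrightarrow> 0 < n \<longrightarrow> length u + length v \<le> n \<longrightarrow>
        algorithm_B m A tA u v \<noteq> {} \<and>
        (\<forall>(es, t) \<in> algorithm_B m A tA u v.
           alignment es u v \<and>
           real (length es) \<le>
             (3 * \<gamma> n) powr (C * max 1 (log (real m) (real n))) * real (edit_dist u v) \<and>
           real t \<le> D * (1 + ln (real n)) ^ k * (real m ^ 5 * T n))"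
proof (rule exI[of _ 2], rule conjI, simp, rule exI[of _ "3 * 23 * 49"], rule conjI, simp,
    rule exI[of _ 3], intro conjI allI impI ballI algorithm_B_nonempty)
  fix A :: "'a list \<Rightarrow> 'a list \<Rightarrow> real" and tA :: "'a list \<Rightarrow> 'a list \<Rightarrow> nat"
    and \<gamma> T and m n :: nat and u v :: "'a list"
  assume A: "approximates A \<gamma>" and T: "runs_in_time tA T" and m: "2 \<le> m" and n: "0 < n"
    and len: "length u + length v \<le> n"
  \<comment> \<open>The exponent constant 2 comes from
    \<open>h \<le> log m n + 1 \<le> 2 * max 1 (log m n)\<close>. The maximum covers
    \<open>n < m\<close>, where the logarithm is below 1 but one level may still be needed.\<close>
  define h where "h = nat \<lceil>log (real m) (real n)\<rceil>"
  have log0: "0 \<le> log (real m) (real n)" using m n by simp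
  have h: "log (real m) (real n) \<le> real h" "real h \<le> log (real m) (real n) + 1"
    using log0 unfolding h_def by linarith+
  have "real n = real m powr log (real m) (real n)" using m n by simp
  also have "\<dots> \<le> real m powr real h" using h m by (intro powr_mono) auto
  finally have "real n \<le> real (m ^ h)" using m by (simp add: powr_realpow)
  then have uh: "length u \<le> m ^ h" using len by linarith
  have \<gamma>: "1 \<le> 3 * \<gamma> n" using approximates_ge_1[OF A n] by simp
  define l where "l = 1 + ln (real n)"
  have l: "1 \<le> l" using n by (simp add: l_def)
  \<comment> \<open>Since \<open>ln m \<ge> 1/2\<close>, the number of levels is at most
    \<open>2 * l\<close>, which contributes the third logarithmic factor beside the two in
    \<open>K\<close>.\<close>
  have "ln 2 \<le> ln (real m)" using m by simp
  moreover have "1 / 2 \<le> ln (2::real)"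
    using ln_le_minus_one[of "1 / 2"] by (simp add: ln_div)
  ultimately have "1 / 2 \<le> ln (real m)" by linarith
  then have "ln (real n) / ln (real m) \<le> ln (real n) / (1 / 2)"
    using n by (intro divide_left_mono) auto
  then have hl: "real h + 1 \<le> 2 * l" using h(2) by (simp add: log_def l_def)
  have Tn: "1 \<le> T n" using runs_in_timeD(1)[OF T, of n] n by linarith
  define K where "K = real m ^ 5 * l\<^sup>2"
  have "1 * 1 \<le> K" unfolding K_def using m l by (intro mult_mono one_le_power) auto
  then have K: "1 \<le> K" by simp
  have TN: "0 \<le> T (length u + length v)" "T (length u + length v) \<le> T n"
    using runs_in_timeD(2)[OF T] T len by (auto simp: runs_in_time_def mono_def)
  show "case x of (es, t) \<Rightarrow> alignment es u v \<and>
           real (length es) \<le>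
             (3 * \<gamma> n) powr (2 * max 1 (log (real m) (real n))) * real (edit_dist u v) \<and>
           real t \<le> 3 * 23 * 49 * (1 + ln (real n)) ^ 3 * (real m ^ 5 * T n)"
    if "x \<in> algorithm_B m A tA u v" for x
  proof -
    obtain es t where x: "x = (es, t)" by (cases x)
    then have B: "(es, t) \<in> algorithm_B m A tA u v" using that by simp
    note corr = algorithm_B_correct[OF A n B uh len]
    have "(3 * \<gamma> n) ^ h = (3 * \<gamma> n) powr real h" using \<gamma> by (simp add: powr_realpow)
    also have "\<dots> \<le> (3 * \<gamma> n) powr (2 * max 1 (log (real m) (real n)))"
      using \<gamma> h(2) by (intro powr_mono) auto
    finally have "(3 * \<gamma> n) ^ h * real (edit_dist u v) \<le>
      (3 * \<gamma> n) powr (2 * max 1 (log (real m) (real n))) * real (edit_dist u v)"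
      by (intro mult_right_mono) auto
    moreover have "real t \<le> 3 * 23 * 49 * (1 + ln (real n)) ^ 3 * (real m ^ 5 * T n)"
    proof -
      have "real t \<le> 1 + (real h + 1) * (23 * 49 * K * T (length u + length v))"
        using algorithm_B_time[OF A T n m B uh len] by (simp add: K_def l_def mult.assoc)
      \<comment> \<open>The leading 1 is absorbed into one extra multiple of \<open>l\<close>, so
        that 2 becomes the 3 in the final constant.\<close>
      also have "\<dots> \<le> l * (23 * 49 * K * T n) + (2 * l) * (23 * 49 * K * T n)"
      proof (rule add_mono)
        have "1 * (1 * 1) \<le> l * (23 * 49 * K * T n)"
          using l K Tn by (intro mult_mono) auto
        then show "1 \<le> l * (23 * 49 * K * T n)" by simp
        show "(real h + 1) * (23 * 49 * K * T (length u + length v)) \<le> (2 * l) * (23 * 49 * K * T n)"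
          using hl l K Tn TN by (intro mult_mono) auto
      qed
      also have "\<dots> = 3 * 23 * 49 * l ^ 3 * (real m ^ 5 * T n)"
        by (simp add: K_def power2_eq_square power3_eq_cube algebra_simps)
      finally show ?thesis by (simp add: l_def)
    qed
    ultimately show ?thesis using x corr by auto
  qed
qed

end
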